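(* For every prime number $p$ and every integer $n\ge 1$, $$B(p,n) \ge \frac{p-1}{p}\, n\log n + n\left(\gamma - 1 - \frac{p-1}{p} - \frac{\gamma}{p}\right),$$ where $\gamma$ denotes the Euler--Mascheroni constant.
   Context: Let $p$ be a prime and $n\ge 1$. Let $V$ be the natural $n$-dimensional permutation representation of the symmetric group $S_n$ over a field of characteristic $p$, and for each integer $r\ge 0$ let $\beta_{r,p}$ be the Brauer character of the symmetric power $\mathrm{Sym}^r V$, a complex-valued class function on the set of elements of $S_n$ of order coprime to $p$. Define $B(p,n)=\dim_{\mathbb{C}}\mathrm{Span}_{\mathbb{C}}\{\beta_{r,p} : r\ge 0\}$. Here $\log$ is the natural logarithm. *)

theory Defs
  imports
    "HOL-Analysis.Analysis"
    "HOL-Algebra.Sym_Groups"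
    "HOL-Algebra.Multiplicative_Group"
    "HOL-Algebra.Algebraic_Closure_Type"
    "HOL-Library.Poly_Mapping"
    "HOL-Library.Multiset"
    "HOL-Library.Function_Algebras"
    "Jordan_Normal_Form.Char_Poly"
begin

definition p_regular :: "nat \<Rightarrow> nat \<Rightarrow> (nat \<Rightarrow> nat) set" where
  "p_regular p n = {g \<in> carrier (sym_group n). coprime (group.ord (sym_group n) g) p}"

(* g maps the basis vector e_j to e_(g j). The group acts on {1..n}, whereas matrix indices
   start at 0. *)
definition nat_perm_mat :: "nat \<Rightarrow> (nat \<Rightarrow> nat) \<Rightarrow> 'k::field mat" where
  "nat_perm_mat n g = mat n n (\<lambda>(i, j). if g (Suc j) = Suc i then 1 else 0)"

(* The symmetric algebra of k^n is the polynomial ring k[e_0, ..., e_(n-1)], realised as the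
   monoid algebra of nat multiset: the monomial e_(i1) ... e_(ir) is the multiset
   {#i1, ..., ir#}. The r-th symmetric power is the homogeneous part of degree r. *)
definition sym_monomials :: "nat \<Rightarrow> nat \<Rightarrow> nat multiset set" where
  "sym_monomials n r = {u. set_mset u \<subseteq> {..<n} \<and> size u = r}"

(* An arbitrary enumeration of the monomial basis; a different one only conjugates
   the matrices below by a permutation matrix. *)
definition sym_basis :: "nat \<Rightarrow> nat \<Rightarrow> nat multiset list" where
  "sym_basis n r = (SOME bs. distinct bs \<and> set bs = sym_monomials n r)"

lemma finite_sym_monomials: "finite (sym_monomials n r)"
proof (rule finite_subset)
  show "sym_monomials n r \<subseteq> mset ` {xs. set xs \<subseteq> {..<n} \<and> length xs = r}"
  proof
    fix u assume u: "u \<in> sym_monomials n r"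
    obtain xs where "mset xs = u" using ex_mset by blast
    with u show "u \<in> mset ` {xs. set xs \<subseteq> {..<n} \<and> length xs = r}"
      by (auto simp: sym_monomials_def)
  qed
qed (simp add: finite_lists_length_eq)

lemma sym_basis: "distinct (sym_basis n r)" "set (sym_basis n r) = sym_monomials n r"
  using someI_ex[of "\<lambda>bs. distinct bs \<and> set bs = sym_monomials n r"]
    finite_distinct_list[OF finite_sym_monomials[of n r]]
  unfolding sym_basis_def by blast+

(* The algebra endomorphism of the symmetric algebra induced by the square matrix A,
   evaluated at the monomial u: each factor e_j is replaced by the j-th column of A. *)
definition sym_image :: "'k::field mat \<Rightarrow> nat multiset \<Rightarrow> (nat multiset \<Rightarrow>\<^sub>0 'k)" where
  "sym_image A u =
     (\<Prod>j\<in>#u. \<Sum>i<dim_row A. Poly_Mapping.single {#i#} (A $$ (i, j)))"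

definition sym_power_mat :: "nat \<Rightarrow> 'k::field mat \<Rightarrow> 'k mat" where
  "sym_power_mat r A =
     (let bs = sym_basis (dim_row A) r
      in mat (length bs) (length bs)
           (\<lambda>(i, j). Poly_Mapping.lookup (sym_image A (bs ! j)) (bs ! i)))"

definition p_prime_roots_of_unity :: "nat \<Rightarrow> 'a::field set" where
  "p_prime_roots_of_unity p = {x. \<exists>m>0. coprime m p \<and> x ^ m = 1}"

(* The choice on which Brauer characters depend: an isomorphism from the p'-roots of unity of an
   algebraic closure in characteristic p to those of the complex numbers. *)
definition brauer_lift :: "nat \<Rightarrow> ('k::field alg_closure \<Rightarrow> complex) \<Rightarrow> bool" where
  "brauer_lift p \<theta> \<longleftrightarrow>
     bij_betw \<theta> (p_prime_roots_of_unity p) (p_prime_roots_of_unity p) \<and>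
     (\<forall>x\<in>p_prime_roots_of_unity p. \<forall>y\<in>p_prime_roots_of_unity p. \<theta> (x * y) = \<theta> x * \<theta> y)"

(* Sum of the lifted eigenvalues, taken in the algebraic closure with multiplicity. *)
definition brauer_value :: "('k::field alg_closure \<Rightarrow> complex) \<Rightarrow> 'k mat \<Rightarrow> complex" where
  "brauer_value \<theta> A = (\<Sum>x\<in>#proots (map_poly to_ac (char_poly A)). \<theta> x)"

(* Functions on p_regular p n are represented by their extension by 0. *)
definition brauer_sym ::
    "nat \<Rightarrow> ('k::field alg_closure \<Rightarrow> complex) \<Rightarrow> nat \<Rightarrow> nat \<Rightarrow> (nat \<Rightarrow> nat) \<Rightarrow> complex" where
  "brauer_sym p \<theta> n r = (\<lambda>g.
     if g \<in> p_regular p n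
     then brauer_value \<theta> (sym_power_mat r (nat_perm_mat n g :: 'k mat)) else 0)"

definition fun_scale :: "complex \<Rightarrow> ('a \<Rightarrow> complex) \<Rightarrow> 'a \<Rightarrow> complex" where
  "fun_scale c f = (\<lambda>x. c * f x)"

lemma vector_space_fun_scale: "vector_space fun_scale"
  by unfold_locales (auto simp: fun_scale_def fun_eq_iff algebra_simps)

definition brauer_sym_dim :: "nat \<Rightarrow> ('k::field alg_closure \<Rightarrow> complex) \<Rightarrow> nat \<Rightarrow> nat" where
  "brauer_sym_dim p \<theta> n =
     vector_space.dim fun_scale (module.span fun_scale (range (brauer_sym p \<theta> n)))"

end

theory Submission
  imports Defs "HOL-Combinatorics.Orbits" "HOL-Computational_Algebra.Polynomial_FPS"
begin

text \<open>
  On an element \<open>g\<close> of order prime to \<open>p\<close>, the matrix of \<open>g\<close> on the monomials of degree \<open>r\<close> is a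
  permutation matrix with cycle lengths prime to \<open>p\<close>; the roots of unity of a nontrivial cycle lift
  to numbers with sum 0, so the Brauer character counts the fixed monomials. Its generating function
  in \<open>r\<close> is the product of \<open>1 / (1 - X ^ l)\<close> over the cycle lengths \<open>l\<close> of \<open>g\<close>.

  The dimension is the rank of the matrix with entries the values of the \<open>r\<close>-th character at \<open>g\<close>,
  so linearly independent generating functions bound it from below. For the identity and the cycle
  types \<open>(d^k, 1^(n - dk))\<close> with \<open>d \<ge> 2\<close> prime to \<open>p\<close> and \<open>k \<ge> 1\<close>, independence follows from
  the order \<open>k\<close> of the pole at a primitive \<open>d\<close>-th root of unity. There are
  \<open>1 + (\<Sum>d. n div d)\<close> such types, and the logarithm comes from the harmonic sum over the \<open>d\<close>
  not divisible by \<open>p\<close>.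
\<close>

section \<open>Separating points and dimension\<close>

text \<open>Serves twice in the rank argument: for functions on the points, where it makes a basis
  finite, and for functions on that basis, where it bounds the number of independent evaluation
  vectors.\<close>

lemma span_of_support:
  fixes f :: "'a \<Rightarrow> complex"
  assumes "finite T" and "\<And>x. x \<notin> T \<Longrightarrow> f x = 0"
  shows "f \<in> module.span fun_scale ((\<lambda>t x. if x = t then 1 else 0) ` T)"
proof -
  interpret vector_space "fun_scale :: complex \<Rightarrow> ('a \<Rightarrow> complex) \<Rightarrow> _"
    by (rule vector_space_fun_scale)
  let ?e = "\<lambda>t x. if x = t then 1 else (0::complex)"
  have sum_apply: "(\<Sum>t\<in>A. fun_scale (f t) (?e t)) x = (\<Sum>t\<in>A. f t * ?e t x)" if "finite A" for A x
    using that by (induction A) (auto simp: fun_scale_def)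
  have "(\<Sum>t\<in>T. fun_scale (f t) (?e t)) \<in> span (?e ` T)"
    by (intro span_sum span_scale span_base) auto
  also have "(\<Sum>t\<in>T. fun_scale (f t) (?e t)) = f"
  proof
    fix x show "(\<Sum>t\<in>T. fun_scale (f t) (?e t)) x = f x"
      using assms by (auto simp: sum_apply if_distrib cong: if_cong)
  qed
  finally show ?thesis .
qed

text \<open>The finite set \<^term>\<open>T\<close> matters: the dimension of an infinite-dimensional span is a junk value.\<close>

lemma card_le_dim_span:
  fixes F :: "('a \<Rightarrow> complex) set" and y :: "'i \<Rightarrow> 'a"
  assumes "finite T" and supp: "\<And>f x. f \<in> F \<Longrightarrow> x \<notin> T \<Longrightarrow> f x = 0"
    and "finite I"
    and sep: "\<And>c i. (\<And>f. f \<in> F \<Longrightarrow> (\<Sum>i\<in>I. c i * f (y i)) = 0) \<Longrightarrow> i \<in> I \<Longrightarrow> c i = 0"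
  shows "card I \<le> vector_space.dim fun_scale (module.span fun_scale F)"
proof -
  interpret vector_space "fun_scale :: complex \<Rightarrow> ('a \<Rightarrow> complex) \<Rightarrow> _"
    by (rule vector_space_fun_scale)
  interpret W: vector_space "fun_scale :: complex \<Rightarrow> (('a \<Rightarrow> complex) \<Rightarrow> complex) \<Rightarrow> _"
    by (rule vector_space_fun_scale)
  obtain B where B: "B \<subseteq> F" "independent B" "F \<subseteq> span B" "card B = dim F"
    by (rule basis_exists)
  have "B \<subseteq> span ((\<lambda>t x. if x = t then 1 else 0) ` T)"
    using B(1) supp by (intro subsetI span_of_support \<open>finite T\<close>) auto
  then have "finite B"
    using independent_span_bound[OF finite_imageI[OF \<open>finite T\<close>] B(2)] by blast
  \<comment> \<open>Row rank against column rank: \<open>v i\<close> is evaluation at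
    \<open>y i\<close>, restricted to the basis \<open>B\<close>. These vectors lie in a space of
    dimension at most \<open>card B\<close>, so their independence bounds
    \<open>card I\<close>.\<close>
  define v where "v i = (\<lambda>b. if b \<in> B then b (y i) else 0)" for i
  \<comment> \<open>A relation among the evaluations that holds on \<open>B\<close> holds on all of
    \<open>F\<close> by linearity, so \<open>sep\<close> applies.\<close>
  have from_basis: "c i = 0" if c: "\<And>b. b \<in> B \<Longrightarrow> (\<Sum>i\<in>I. c i * b (y i)) = 0" and "i \<in> I" for c i
  proof (rule sep[OF _ \<open>i \<in> I\<close>])
    fix f assume "f \<in> F"
    with B(3) have "f \<in> span B" by blast
    then show "(\<Sum>i\<in>I. c i * f (y i)) = 0"
    proof (induction rule: span_induct_alt)
      case base
      show ?case by simp
    next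
      case (step a b f)
      have "(\<Sum>i\<in>I. c i * (fun_scale a b + f) (y i))
          = a * (\<Sum>i\<in>I. c i * b (y i)) + (\<Sum>i\<in>I. c i * f (y i))"
        by (simp add: fun_scale_def sum_distrib_left algebra_simps sum.distrib)
      then show ?case using c step by simp
    qed
  qed
  have inj: "inj_on v I"
  proof
    fix i k assume ik: "i \<in> I" "k \<in> I" "v i = v k"
    show "i = k"
    proof (rule ccontr)
      assume "i \<noteq> k"
      \<comment> \<open>Independence of the image set says nothing about repeated vectors. Equal
        vectors at \<open>i\<close> and \<open>k\<close> would give a relation with coefficients 1
        and -1, which is excluded as well.\<close>
      let ?c = "\<lambda>t. if t = i then 1 else if t = k then - 1 else (0::complex)"
      have "?c i = 0"
      proof (rule from_basis[of ?c, OF _ ik(1)])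
        fix b assume "b \<in> B"
        with ik(3) have "b (y i) = b (y k)" by (metis v_def)
        have "(\<Sum>t\<in>I. ?c t * b (y t)) = (\<Sum>t\<in>{i, k}. ?c t * b (y t))"
          using ik \<open>finite I\<close> by (intro sum.mono_neutral_right) auto
        then show "(\<Sum>t\<in>I. ?c t * b (y t)) = 0"
          using \<open>i \<noteq> k\<close> \<open>b (y i) = b (y k)\<close> by simp
      qed
      then show False by simp
    qed
  qed
  have "W.independent (v ` I)"
  proof
    assume "W.dependent (v ` I)"
    then obtain u w where 0: "(\<Sum>w\<in>v ` I. fun_scale (u w) w) = 0" and "w \<in> v ` I" "u w \<noteq> 0"
      unfolding W.dependent_finite[OF finite_imageI[OF \<open>finite I\<close>]] by blast
    then obtain i where i: "i \<in> I" "w = v i" by blast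
    have sum_apply: "(\<Sum>i\<in>A. fun_scale (u (v i)) (v i)) b = (\<Sum>i\<in>A. u (v i) * v i b)"
      if "finite A" for A b
      using that by (induction A) (auto simp: fun_scale_def)
    have v_b: "v i b = b (y i)" if "b \<in> B" for i b using that by (simp add: v_def)
    have "(\<Sum>i\<in>I. u (v i) * b (y i)) = 0" if "b \<in> B" for b
    proof -
      have "(\<Sum>i\<in>I. u (v i) * b (y i)) = (\<Sum>i\<in>I. fun_scale (u (v i)) (v i)) b"
        unfolding sum_apply[OF \<open>finite I\<close>]
        using v_b[OF that] by simp
      also have "(\<Sum>i\<in>I. fun_scale (u (v i)) (v i)) = 0"
        using 0 by (simp add: sum.reindex[OF inj])
      finally show ?thesis by simp
    qed
    then have "u (v i) = 0" by (rule from_basis[of "\<lambda>i. u (v i)", OF _ i(1)])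
    with \<open>u w \<noteq> 0\<close> show False unfolding i(2) by contradiction
  qed
  moreover have sub: "v ` I \<subseteq> W.span ((\<lambda>t x. if x = t then 1 else 0) ` B)"
  proof
    fix w assume "w \<in> v ` I"
    then obtain i where w: "w = v i" by blast
    show "w \<in> W.span ((\<lambda>t x. if x = t then 1 else 0) ` B)"
      unfolding w by (rule span_of_support[OF \<open>finite B\<close>]) (simp add: v_def)
  qed
  ultimately have "card (v ` I) \<le> card ((\<lambda>t x. if x = t then 1 else (0::complex)) ` B)"
    using W.independent_span_bound[OF finite_imageI[OF \<open>finite B\<close>]] by simp
  also have "\<dots> \<le> card B" by (rule card_image_le[OF \<open>finite B\<close>])
  finally show ?thesis using B(4) by (simp add: card_image[OF inj])
qed

section \<open>Brauer values of permutation matrices\<close>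

lemma inj_on_if_funpow_id:
  assumes "\<And>x. x \<in> A \<Longrightarrow> (f ^^ m) x = x" and "m > 0" shows "inj_on f A"
proof
  fix x y assume xy: "x \<in> A" "y \<in> A" "f x = f y"
  then have "(f ^^ Suc (m - 1)) x = (f ^^ Suc (m - 1)) y" by (simp only: funpow_Suc_right o_apply)
  then show "x = y" using assms xy by simp
qed

text \<open>\<^term>\<open>c x\<close> is a representative of the cycle through \<^term>\<open>x\<close>, \<^term>\<open>l (c x)\<close> its length
  and \<^term>\<open>j x\<close> the position of \<^term>\<open>x\<close> on it.\<close>

lemma cycle_coordinates:
  fixes t :: "'a \<Rightarrow> 'a"
  assumes "finite Y" "bij_betw t Y Y"
  obtains c :: "'a \<Rightarrow> 'a" and j :: "'a \<Rightarrow> nat" and l :: "'a \<Rightarrow> nat"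
  where "bij_betw (\<lambda>x. (c x, j x)) Y (Sigma (c ` Y) (\<lambda>a. {..<l a}))"
    and "\<And>x. x \<in> Y \<Longrightarrow> c (t x) = c x"
    and "\<And>x. x \<in> Y \<Longrightarrow> j (t x) = Suc (j x) mod l (c x)"
proof -
  \<comment> \<open>Extending \<open>t\<close> by the identity gives a permutation of the whole
    type, to which the theory of orbits applies.\<close>
  define f where "f x = (if x \<in> Y then t x else x)" for x
  have "bij_betw f Y Y"
    using assms(2) by (subst bij_betw_cong[of Y f t]) (auto simp: f_def)
  then have fY: "f permutes Y"
    by (rule bij_imp_permutes) (simp add: f_def)
  then have perm: "permutation f"
    using \<open>finite Y\<close> by (auto simp: permutation_permutes)
  \<comment> \<open>The choice depends on the orbit only, hence is constant along each
    cycle.\<close>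
  define c where "c x = (SOME y. y \<in> orbit f x)" for x
  have c_orbit: "c x \<in> orbit f x" for x
    unfolding c_def by (rule someI[of _ x]) (rule permutation_self_in_orbit[OF perm])
  have orbit_c: "orbit f (c x) = orbit f x" for x
    by (rule orbit_cyclic_eq3[OF cyclic_on_orbit[OF fY \<open>finite Y\<close>] c_orbit])
  have c_eq: "c x = c z" if "orbit f x = orbit f z" for x z
    using that by (simp add: c_def)
  have x_orbit: "x \<in> orbit f (c x)" for x
    using orbit_c permutation_self_in_orbit[OF perm] by simp
  have c_f: "c (f x) = c x" for x
    by (rule c_eq) (rule permutation_orbit_step[OF perm])
  have c_pow: "c ((f ^^ i) x) = c x" for x i
    by (induction i) (auto simp: c_f)
  have cc: "c (c x) = c x" for x by (rule c_eq) (rule orbit_c)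
  define l where "l a = funpow_dist1 f a a" for a
  have l_pos: "l a > 0" for a by (simp add: l_def)
  have pow_l: "(f ^^ l a) a = a" for a
    unfolding l_def by (rule funpow_dist1_prop[OF permutation_self_in_orbit[OF perm]])
  have pow_mod: "(f ^^ (i mod l a)) a = (f ^^ i) a" for i a
    by (rule funpow_mod_eq[OF pow_l])
  have inj: "inj_on (\<lambda>i. (f ^^ i) a) {0..<l a}" for a
    unfolding l_def by (rule inj_on_funpow_dist1[OF permutation_self_in_orbit[OF perm]])
  define j where "j x = (SOME i. i < l (c x) \<and> (f ^^ i) (c x) = x)" for x
  have j: "j x < l (c x) \<and> (f ^^ j x) (c x) = x" for x
  proof -
    have "x \<in> (\<lambda>n. (f ^^ n) (c x)) ` {0..<l (c x)}"
      using x_orbit[of x] orbit_conv_funpow_dist1[OF permutation_self_in_orbit[OF perm], of "c x"]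
      by (simp add: l_def)
    then have "\<exists>i. i < l (c x) \<and> (f ^^ i) (c x) = x" by force
    then show ?thesis unfolding j_def by (rule someI_ex)
  qed
  have j_eqI: "j x = i" if "i < l (c x)" "(f ^^ i) (c x) = x" for x i
    by (rule inj_onD[OF inj[of "c x"]]) (use that j[of x] in auto)
  have f_tau: "f x = t x" if "x \<in> Y" for x using that by (simp add: f_def)
  have cY: "c x \<in> Y" if "x \<in> Y" for x
    using permutes_orbit_subset[OF fY that] c_orbit by blast
  have powY: "(f ^^ i) x \<in> Y" if "x \<in> Y" for x i
    using that permutes_in_image[OF fY] by (induction i) auto
  show thesis
  proof (rule that[of c j l])
    show "bij_betw (\<lambda>x. (c x, j x)) Y (Sigma (c ` Y) (\<lambda>a. {..<l a}))"
    proof (rule bij_betw_byWitness[where f' = "\<lambda>(a, i). (f ^^ i) a"])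
      show "\<forall>x\<in>Y. (case (c x, j x) of (a, i) \<Rightarrow> (f ^^ i) a) = x" using j by simp
      show "\<forall>ai\<in>Sigma (c ` Y) (\<lambda>a. {..<l a}).
          (c (case ai of (a, i) \<Rightarrow> (f ^^ i) a), j (case ai of (a, i) \<Rightarrow> (f ^^ i) a)) = ai"
        by (auto simp: c_pow cc intro!: j_eqI)
      show "(\<lambda>x. (c x, j x)) ` Y \<subseteq> (Sigma (c ` Y) (\<lambda>a. {..<l a}))" using j by auto
      show "(\<lambda>(a, i). (f ^^ i) a) ` (Sigma (c ` Y) (\<lambda>a. {..<l a})) \<subseteq> Y" using cY powY by auto
    qed
    fix x assume x: "x \<in> Y"
    show "c (t x) = c x" using c_f[of x] f_tau[OF x] by simp
    show "j (t x) = Suc (j x) mod l (c x)"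
    proof (rule j_eqI)
      show "Suc (j x) mod l (c x) < l (c (t x))"
        using c_f[of x] f_tau[OF x] l_pos by simp
      have "(f ^^ Suc (j x)) (c x) = t x" using j[of x] f_tau[OF x] by simp
      then show "(f ^^ (Suc (j x) mod l (c x))) (c (t x)) = t x"
        using c_f[of x] f_tau[OF x] pow_mod by simp
    qed
  qed
qed

section \<open>Roots of unity and their lifts\<close>

lemma ex_primitive_root_of_unity_complex:
  assumes "l > 0"
  obtains z :: complex where "z ^ l = 1" and "\<And>i. 0 < i \<Longrightarrow> i < l \<Longrightarrow> z ^ i \<noteq> 1"
proof
  let ?z = "cis (2 * pi / real l)"
  show "?z ^ l = 1" using assms by (simp add: Complex.DeMoivre)
  show "?z ^ i \<noteq> 1" if "0 < i" "i < l" for i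
  proof
    assume "?z ^ i = 1"
    then have "cis (2 * pi * (real i / real l)) = 1" by (simp add: Complex.DeMoivre mult.commute)
    then obtain k :: int where "2 * pi * (real i / real l) = of_int k * 2 * pi"
      by (auto simp: complex_eq_iff cos_one_2pi_int)
    then have "(2 * pi) * real i = (2 * pi) * (of_int k * real l)"
      using assms by (simp add: field_simps)
    then have "real i = of_int k * real l" by simp
    then have "int i = k * int l" by (metis of_int_eq_iff of_int_mult of_int_of_nat_eq)
    with that show False
      by (metis mult.commute nat_dvd_not_less dvd_triv_left int_dvd_int_iff)
  qed
qed

text \<open>Pulling back a complex primitive root along \<^term>\<open>\<theta>\<close> makes a separate existence proof in the
  algebraic closure unnecessary.\<close>

lemma brauer_lift_primitive_root:
  fixes \<theta> :: "'k::field alg_closure \<Rightarrow> complex"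
  assumes "brauer_lift p \<theta>" and "l > 0" and "coprime l p"
  obtains w where "w ^ l = 1" and "\<And>i. i < l \<Longrightarrow> w ^ i = 1 \<Longrightarrow> i = 0"
    and "(\<Sum>i<l. \<theta> (w ^ i)) = (if l = 1 then 1 else 0)"
proof -
  let ?R = "p_prime_roots_of_unity p"
  have bij: "bij_betw \<theta> ?R ?R"
    and mult: "\<And>x y. x \<in> ?R \<Longrightarrow> y \<in> ?R \<Longrightarrow> \<theta> (x * y) = \<theta> x * \<theta> y"
    using assms(1) by (auto simp: brauer_lift_def)
  have one: "1 \<in> p_prime_roots_of_unity p"
    by (auto simp: p_prime_roots_of_unity_def intro: exI[of _ 1])
  \<comment> \<open>\<open>\<theta> 1\<close> is idempotent, and nonzero because 0 is not a root of
    unity.\<close>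
  have "\<theta> 1 * \<theta> 1 = \<theta> 1" using mult[OF one one] by simp
  moreover have "\<theta> 1 \<noteq> 0"
  proof -
    have "\<theta> 1 \<in> ?R" using bij one by (auto simp: bij_betw_def)
    then show ?thesis by (auto simp: p_prime_roots_of_unity_def power_0_left)
  qed
  ultimately have theta_1: "\<theta> 1 = 1" by simp
  have inj: "x = y" if "x \<in> ?R" "y \<in> ?R" "\<theta> x = \<theta> y" for x y
    using bij that by (auto simp: bij_betw_def dest: inj_onD)
  obtain z :: complex where zl: "z ^ l = 1" and z_ne: "\<And>i. 0 < i \<Longrightarrow> i < l \<Longrightarrow> z ^ i \<noteq> 1"
    using ex_primitive_root_of_unity_complex[OF \<open>l > 0\<close>] by blast
  have "z \<in> ?R" using assms(2,3) zl by (auto simp: p_prime_roots_of_unity_def)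
  then obtain w where w: "w \<in> ?R" "\<theta> w = z" using bij_betw_imp_surj_on[OF bij] by (metis imageE)
  have power: "w ^ i \<in> ?R \<and> \<theta> (w ^ i) = z ^ i" for i
  proof (induction i)
    case 0 show ?case using one theta_1 by simp
  next
    case (Suc i)
    obtain m where "m > 0" "coprime m p" "w ^ m = 1" using w by (auto simp: p_prime_roots_of_unity_def)
    then have "(w ^ Suc i) ^ m = 1" by (metis power_commutes power_mult power_one mult.commute)
    with \<open>m > 0\<close> \<open>coprime m p\<close> have "w ^ Suc i \<in> ?R" by (auto simp: p_prime_roots_of_unity_def)
    then show ?case using Suc w mult[of w "w ^ i"] by simp
  qed
  show thesis
  proof
    show "w ^ l = 1" by (rule inj) (use power zl theta_1 one in auto)
    show "i = 0" if "i < l" "w ^ i = 1" for i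
      using that power[of i] theta_1 z_ne[of i] by fastforce
    have "(\<Sum>i<l. \<theta> (w ^ i)) = (\<Sum>i<l. z ^ i)" using power by simp
    also have "\<dots> = (if l = 1 then 1 else 0)"
    proof (cases "l = 1")
      case False
      then have "z \<noteq> 1" using z_ne[of 1] \<open>l > 0\<close> by auto
      then have "(\<Sum>i<l. z ^ i) = 0" using geometric_sum[of z l] zl by simp
      then show ?thesis using False by simp
    qed simp
    finally show "(\<Sum>i<l. \<theta> (w ^ i)) = (if l = 1 then 1 else 0)" .
  qed
qed

section \<open>Diagonalisation of permutation matrices\<close>

lemma sum_nth_distinct:
  assumes "distinct bs" shows "(\<Sum>i<length bs. f (bs ! i)) = (\<Sum>y\<in>set bs. f y)"
  by (rule sum.reindex_bij_betw[OF bij_betw_nth[OF assms refl refl]])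

lemma power_mod_exponent:
  fixes v :: "'k::monoid_mult"
  assumes "v ^ l = 1" shows "v ^ (m mod l) = v ^ m"
proof -
  have "v ^ m = v ^ (l * (m div l) + m mod l)" by simp
  also have "\<dots> = v ^ (m mod l)" by (simp only: power_add power_mult assms power_one mult_1)
  finally show ?thesis by simp
qed

text \<open>Orthogonality of the powers of a primitive root: the sum is geometric, and its ratio is
  an \<open>l\<close>-th root of unity that equals 1 only for \<open>m = n\<close>.\<close>

lemma sum_power_root_of_unity:
  fixes w :: "'k::field"
  assumes "w ^ l = 1" and prim: "\<And>i. i < l \<Longrightarrow> w ^ i = 1 \<Longrightarrow> i = 0" and "m < l" "n < l"
  shows "(\<Sum>i<l. inverse w ^ (m * i) * w ^ (i * n)) = (if m = n then of_nat l else 0)"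
proof -
  have "w \<noteq> 0" using assms by (metis power_0_left gr_implies_not0 zero_neq_one)
  define u where "u = inverse w ^ m * w ^ n"
  have "(\<Sum>i<l. inverse w ^ (m * i) * w ^ (i * n)) = (\<Sum>i<l. u ^ i)"
    by (simp add: u_def power_mult_distrib power_mult [symmetric] mult.commute)
  also have "\<dots> = (if m = n then of_nat l else 0)"
  proof (cases "m = n")
    case True
    then have "u = 1" using \<open>w \<noteq> 0\<close> by (simp add: u_def power_inverse)
    then show ?thesis using True by simp
  next
    case False
    have "u ^ l = inverse (w ^ l) ^ m * (w ^ l) ^ n"
      by (simp add: u_def power_mult_distrib power_mult [symmetric] power_inverse mult.commute)
    then have "u ^ l = 1" using assms by simp
    moreover have "u \<noteq> 1"
    proof
      assume "u = 1"
      then have eq: "w ^ n = w ^ m" using \<open>w \<noteq> 0\<close> by (simp add: u_def power_inverse field_simps)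
      have "a = b" if "a < l" "b < l" "a \<le> b" "w ^ a = w ^ b" for a b
      proof -
        have "w ^ b = w ^ (a + (b - a))" using that by simp
        then have "w ^ a * w ^ (b - a) = w ^ a * 1" using that(4) by (simp only: power_add mult_1_right)
        then have "w ^ (b - a) = 1" using \<open>w \<noteq> 0\<close> by simp
        then have "b - a = 0" by (rule prim[rotated]) (use that in auto)
        with that show "a = b" by simp
      qed
      from this[of m n] this[of n m] show False using eq assms False by (metis linear)
    qed
    ultimately show ?thesis using False geometric_sum[of u l] by simp
  qed
  finally show ?thesis .
qed

text \<open>The matrix \<open>S\<close> below, a discrete Fourier transform on each cycle, diagonalises the permutation
  matrix; \<open>R\<close> is its inverse.\<close>

lemma char_poly_permutation:
  fixes bs :: "'a list" and t c :: "'a \<Rightarrow> 'a" and j l :: "'a \<Rightarrow> nat" and w :: "'a \<Rightarrow> 'k::field"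
  assumes "distinct bs" and t: "bij_betw t (set bs) (set bs)"
    and bij: "bij_betw (\<lambda>x. (c x, j x)) (set bs) (Sigma (c ` set bs) (\<lambda>a. {..<l a}))"
    and c_t: "\<And>x. x \<in> set bs \<Longrightarrow> c (t x) = c x"
    and j_t: "\<And>x. x \<in> set bs \<Longrightarrow> j (t x) = Suc (j x) mod l (c x)"
    and w: "\<And>x. x \<in> set bs \<Longrightarrow> w (c x) ^ l (c x) = 1"
    and prim: "\<And>x i. x \<in> set bs \<Longrightarrow> i < l (c x) \<Longrightarrow> w (c x) ^ i = 1 \<Longrightarrow> i = 0"
    and l_nz: "\<And>x. x \<in> set bs \<Longrightarrow> of_nat (l (c x)) \<noteq> (0 :: 'k)"
  shows "char_poly (mat (length bs) (length bs) (\<lambda>(i, k). if t (bs ! k) = bs ! i then 1 else 0))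
    = (\<Prod>x\<leftarrow>bs. [:- (w (c x) ^ j x), 1:])"
proof -
  define N where "N = length bs"
  define s where "s x y = (if c x = c y then inverse (w (c x)) ^ (j x * j y) else 0)" for x y
  \<comment> \<open>The inverse transform divides by the cycle length, which is invertible by
    \<open>l_nz\<close>.\<close>
  define r where "r x y = (if c x = c y then w (c x) ^ (j x * j y) / of_nat (l (c x)) else 0)" for x y
  define A where "A = mat N N (\<lambda>(i, k). if t (bs ! k) = bs ! i then 1 else (0 :: 'k))"
  define S where "S = mat N N (\<lambda>(i, k). s (bs ! i) (bs ! k))"
  define R where "R = mat N N (\<lambda>(i, k). r (bs ! i) (bs ! k))"
  define D where "D = mat N N (\<lambda>(i, k). if i = k then w (c (bs ! k)) ^ j (bs ! k) else 0)"
  have carrier: "A \<in> carrier_mat N N" "S \<in> carrier_mat N N" "R \<in> carrier_mat N N" "D \<in> carrier_mat N N"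
    by (simp_all add: A_def S_def R_def D_def)
  have sum_nth: "(\<Sum>i<N. f (bs ! i)) = (\<Sum>y\<in>set bs. f y)" for f :: "'a \<Rightarrow> 'k"
    unfolding N_def by (rule sum_nth_distinct[OF assms(1)])
  have j_less: "j x < l (c x)" if "x \<in> set bs" for x
    using bij that by (auto simp: bij_betw_def)
  have sum_cycle: "(\<Sum>y\<in>set bs. if c y = c x then f (j y) else 0) = (\<Sum>i<l (c x). f i)"
    if x: "x \<in> set bs" for f :: "nat \<Rightarrow> 'k" and x
  proof -
    have "(\<Sum>y\<in>set bs. if c y = c x then f (j y) else 0)
        = (\<Sum>(a, i)\<in>Sigma (c ` set bs) (\<lambda>a. {..<l a}). if a = c x then f i else 0)"
      using sum.reindex_bij_betw[OF bij, of "\<lambda>(a, i). if a = c x then f i else 0"] by simp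
    also have "\<dots> = (\<Sum>a\<in>c ` set bs. \<Sum>i<l a. if a = c x then f i else 0)"
      by (subst sum.Sigma) auto
    also have "\<dots> = (\<Sum>a\<in>c ` set bs. if a = c x then \<Sum>i<l a. f i else 0)"
      by (intro sum.cong) auto
    also have "\<dots> = (\<Sum>i<l (c x). f i)" using x by (subst sum.delta) auto
    finally show ?thesis .
  qed
  have SR: "S * R = 1\<^sub>m N"
  proof (rule eq_matI)
    fix i k assume "i < dim_row (1\<^sub>m N :: 'k mat)" "k < dim_col (1\<^sub>m N :: 'k mat)"
    then have ik: "i < N" "k < N" by auto
    define x z where "x = bs ! i" and "z = bs ! k"
    have xz: "x \<in> set bs" "z \<in> set bs" using ik by (auto simp: x_def z_def N_def)
    have "(S * R) $$ (i, k) = (\<Sum>q<N. s x (bs ! q) * r (bs ! q) z)"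
      using ik by (simp add: S_def R_def scalar_prod_def x_def z_def atLeast0LessThan)
    also have "\<dots> = (\<Sum>y\<in>set bs. s x y * r y z)" by (rule sum_nth)
    also have "\<dots> = (if x = z then 1 else 0)"
    proof (cases "c x = c z")
      case False
      then have "(\<Sum>y\<in>set bs. s x y * r y z) = 0" by (intro sum.neutral) (auto simp: s_def r_def)
      then show ?thesis using False by auto
    next
      case True
      have "(\<Sum>y\<in>set bs. s x y * r y z) = (\<Sum>y\<in>set bs. if c y = c x
          then inverse (w (c x)) ^ (j x * j y) * w (c x) ^ (j y * j z) / of_nat (l (c x)) else 0)"
        using True by (intro sum.cong) (auto simp: s_def r_def)
      also have "\<dots> = (\<Sum>i<l (c x). inverse (w (c x)) ^ (j x * i) * w (c x) ^ (i * j z) / of_nat (l (c x)))"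
        by (rule sum_cycle[OF xz(1)])
      also have "\<dots> = (\<Sum>i<l (c x). inverse (w (c x)) ^ (j x * i) * w (c x) ^ (i * j z)) / of_nat (l (c x))"
        by (rule sum_divide_distrib[symmetric])
      also have "\<dots> = (if j x = j z then 1 else 0)"
        using l_nz[OF xz(1)] j_less[OF xz(1)] j_less[OF xz(2)] xz True
        by (subst sum_power_root_of_unity[OF w prim]) auto
      also have "j x = j z \<longleftrightarrow> x = z"
        using bij xz True by (auto simp: bij_betw_def dest: inj_onD)
      finally show ?thesis .
    qed
    also have "x = z \<longleftrightarrow> i = k"
      using ik assms(1) by (simp add: x_def z_def N_def nth_eq_iff_index_eq)
    finally show "(S * R) $$ (i, k) = 1\<^sub>m N $$ (i, k)" using ik by simp
  qed (use carrier in auto)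
  have RS: "R * S = 1\<^sub>m N"
    by (rule mat_mult_left_right_inverse[OF carrier(2,3) SR])
  have AS: "A * S = S * D"
  proof (rule eq_matI)
    fix i k assume "i < dim_row (S * D)" "k < dim_col (S * D)"
    then have ik: "i < N" "k < N" using carrier by auto
    define x z where "x = bs ! i" and "z = bs ! k"
    have xz: "x \<in> set bs" "z \<in> set bs" using ik by (auto simp: x_def z_def N_def)
    then obtain y0 where y0: "y0 \<in> set bs" "x = t y0" using t by (auto simp: bij_betw_def)
    have "(A * S) $$ (i, k) = (\<Sum>q<N. (if t (bs ! q) = x then 1 else 0) * s (bs ! q) z)"
      using ik by (simp add: A_def S_def scalar_prod_def x_def z_def atLeast0LessThan)
    also have "\<dots> = (\<Sum>y\<in>set bs. (if t y = x then 1 else 0) * s y z)" by (rule sum_nth)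
    also have "\<dots> = (\<Sum>y\<in>set bs. if y = y0 then s y z else 0)"
      using y0 t by (intro sum.cong) (auto simp: bij_betw_def dest: inj_onD)
    also have "\<dots> = s y0 z" using y0 by simp
    \<comment> \<open>Column \<open>z\<close> of \<open>S\<close> is an eigenvector: one step along
      the cycle divides the entry by the eigenvalue \<open>w (c z) ^ j z\<close>, and
      \<open>w (c z) ^ l (c z) = 1\<close> absorbs the jump from the last position back to
      0.\<close>
    also have "\<dots> = s x z * w (c z) ^ j z"
    proof (cases "c y0 = c z")
      case True
      define v where "v = inverse (w (c z))"
      have "v ^ l (c z) = 1" using w[OF xz(2)] by (simp add: v_def power_inverse)
      then have "v ^ (Suc (j y0) mod l (c z)) = v ^ Suc (j y0)" by (rule power_mod_exponent)
      then have "v ^ (Suc (j y0) mod l (c z) * j z) = v ^ (Suc (j y0) * j z)"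
        by (simp only: power_mult)
      moreover have "v ^ j z * w (c z) ^ j z = 1"
      proof -
        have "w (c z) \<noteq> 0" using w[OF xz(2)] j_less[OF xz(2)] by (metis power_0_left gr_implies_not0 zero_neq_one)
        then show ?thesis by (simp add: v_def flip: power_mult_distrib)
      qed
      ultimately have "v ^ (j y0 * j z) = v ^ (Suc (j y0) mod l (c z) * j z) * w (c z) ^ j z"
        by (simp add: power_add)
      then show ?thesis using True c_t[OF y0(1)] j_t[OF y0(1)]
        by (simp add: s_def y0(2) v_def)
    next
      case False
      then show ?thesis using c_t[OF y0(1)] by (simp add: s_def y0(2))
    qed
    also have "\<dots> = (\<Sum>q<N. s x (bs ! q) * (if q = k then w (c z) ^ j z else 0))"
      using ik by (simp add: z_def if_distrib cong: if_cong)
    also have "\<dots> = (S * D) $$ (i, k)"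
      using ik by (simp add: S_def D_def scalar_prod_def x_def z_def atLeast0LessThan cong: if_cong)
    finally show "(A * S) $$ (i, k) = (S * D) $$ (i, k)" .
  qed (use carrier in auto)
  have "A = A * (S * R)" using carrier by (simp add: SR)
  also have "\<dots> = S * D * R" using carrier by (simp add: AS flip: assoc_mult_mat)
  finally have "similar_mat A D"
    by (intro similar_matI[OF _ SR RS]) (use carrier in auto)
  then have "char_poly A = char_poly D" by (rule char_poly_similar)
  also have "\<dots> = (\<Prod>a\<leftarrow>diag_mat D. [:- a, 1:])"
    by (rule char_poly_upper_triangular[OF carrier(4)]) (auto simp: D_def)
  also have "diag_mat D = map (\<lambda>x. w (c x) ^ j x) bs"
    by (rule nth_equalityI) (auto simp: diag_mat_def D_def N_def)
  finally show ?thesis by (simp add: A_def N_def o_def)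
qed

text \<open>The eigenvalues on a cycle of length \<open>l\<close> are the powers of a primitive
  \<open>l\<close>-th root of unity, and their lifts sum to 0 unless \<open>l = 1\<close>. The
  exponent \<open>m\<close> forces every cycle length to be prime to \<open>p\<close>, so that such
  a root exists and \<open>l\<close> is invertible in the field.\<close>

lemma brauer_value_permutation:
  fixes \<theta> :: "'k::field alg_closure \<Rightarrow> complex"
  assumes "Factorial_Ring.prime p" "CHAR('k) = p" "brauer_lift p \<theta>"
    and "distinct bs" and t: "bij_betw t (set bs) (set bs)"
    and "m > 0" "coprime m p" and t_m: "\<And>x. x \<in> set bs \<Longrightarrow> (t ^^ m) x = x"
  shows "brauer_value \<theta> (mat (length bs) (length bs)
      (\<lambda>(i, k). if t (bs ! k) = bs ! i then 1 else 0) :: 'k mat) = of_nat (card {x\<in>set bs. t x = x})"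
proof -
  obtain c :: "'a \<Rightarrow> 'a" and j l :: "'a \<Rightarrow> nat"
    where bij: "bij_betw (\<lambda>x. (c x, j x)) (set bs) (Sigma (c ` set bs) (\<lambda>a. {..<l a}))"
      and c_t: "\<And>x. x \<in> set bs \<Longrightarrow> c (t x) = c x"
      and j_t: "\<And>x. x \<in> set bs \<Longrightarrow> j (t x) = Suc (j x) mod l (c x)"
    using cycle_coordinates[OF _ t] by auto
  have j_less: "j x < l (c x)" if "x \<in> set bs" for x
    using bij that by (auto simp: bij_betw_def)
  have t_in: "t x \<in> set bs" if "x \<in> set bs" for x
    using t that by (auto simp: bij_betw_def)
  have iter: "(t ^^ i) x \<in> set bs \<and> c ((t ^^ i) x) = c x \<and> j ((t ^^ i) x) = (j x + i) mod l (c x)"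
    if x: "x \<in> set bs" for x i
  proof (induction i)
    case (Suc i)
    then show ?case using c_t[of "(t ^^ i) x"] j_t[of "(t ^^ i) x"] t_in[of "(t ^^ i) x"]
      by (simp add: mod_Suc_eq)
  qed (use x j_less in simp)
  have l_cop: "coprime (l (c x)) p" if x: "x \<in> set bs" for x
  proof -
    \<comment> \<open>Applying \<open>t\<close> \<open>m\<close> times adds \<open>m\<close> to the
      position modulo the cycle length, and returns to the start.\<close>
    have "(j x + m) mod l (c x) = j x mod l (c x)"
      using iter[OF x, of m] t_m[OF x] j_less[OF x] by simp
    then have "l (c x) dvd m" using mod_eq_dvd_iff_nat[of "j x" "j x + m" "l (c x)"] by simp
    then show ?thesis using coprime_divisors[OF _ dvd_refl \<open>coprime m p\<close>] by simp
  qed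
  define P where "P l w \<longleftrightarrow> w ^ l = 1 \<and> (\<forall>i<l. w ^ i = 1 \<longrightarrow> i = 0) \<and>
    (\<Sum>i<l. \<theta> (w ^ i)) = (if l = 1 then 1 else 0)" for l w
  \<comment> \<open>One root is chosen per representative, so all points of a cycle share
    it.\<close>
  define w where "w a = (SOME w. P (l a) w)" for a
  have P: "P (l (c x)) (w (c x))" if x: "x \<in> set bs" for x
  proof -
    have "\<exists>w. P (l (c x)) w"
      using brauer_lift_primitive_root[OF assms(3) _ l_cop[OF x]] j_less[OF x]
      unfolding P_def by (metis gr_implies_not0 neq0_conv)
    then show ?thesis unfolding w_def by (rule someI_ex)
  qed
  have l_nz: "of_nat (l (c x)) \<noteq> (0 :: 'k alg_closure)" if x: "x \<in> set bs" for x
  proof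
    assume "of_nat (l (c x)) = (0 :: 'k alg_closure)"
    then have "p dvd l (c x)" using assms(2) by (simp add: of_nat_eq_0_iff_char_dvd)
    then show False using l_cop[OF x] assms(1) by (metis coprime_absorb_right not_prime_unit)
  qed
  let ?A = "mat (length bs) (length bs) (\<lambda>(i, k). if t (bs ! k) = bs ! i then 1 else 0) :: 'k mat"
  interpret ac: comm_ring_hom "to_ac :: 'k \<Rightarrow> 'k alg_closure" by unfold_locales auto
  have "map_poly to_ac (char_poly ?A) = char_poly (map_mat to_ac ?A)"
    by (rule ac.char_poly_hom [where n = "length bs", symmetric]) simp
  also have "map_mat to_ac ?A = (mat (length bs) (length bs)
      (\<lambda>(i, k). if t (bs ! k) = bs ! i then 1 else 0) :: 'k alg_closure mat)"
    by (rule eq_matI) auto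
  also have "char_poly \<dots> = (\<Prod>x\<leftarrow>bs. [:- (w (c x) ^ j x), 1:])"
    using P l_nz by (intro char_poly_permutation[OF assms(4) t bij c_t j_t]) (auto simp: P_def)
  finally have "map_poly to_ac (char_poly ?A) = (\<Prod>x\<leftarrow>bs. [:- (w (c x) ^ j x), 1:])" .
  moreover have "proots (\<Prod>x\<leftarrow>bs. [:- (w (c x) ^ j x), 1:]) = mset (map (\<lambda>x. w (c x) ^ j x) bs)"
    for bs
  proof (induction bs)
    case (Cons a bs)
    have "(\<Prod>x\<leftarrow>bs. [:- (w (c x) ^ j x), 1:]) \<noteq> 0" by (auto simp: prod_list_zero_iff)
    then show ?case using Cons by (simp add: proots_mult del: mult_pCons_left)
  qed simp
  ultimately have "brauer_value \<theta> ?A = (\<Sum>x\<in>set bs. \<theta> (w (c x) ^ j x))"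
    using assms(4) by (simp add: brauer_value_def sum_unfold_sum_mset mset_set_set image_mset.compositionality o_def)
  also have "\<dots> = (\<Sum>(a, i)\<in>Sigma (c ` set bs) (\<lambda>a. {..<l a}). \<theta> (w a ^ i))"
    using sum.reindex_bij_betw[OF bij, of "\<lambda>(a, i). \<theta> (w a ^ i)"] by simp
  also have "\<dots> = (\<Sum>a\<in>c ` set bs. \<Sum>i<l a. \<theta> (w a ^ i))"
    by (subst sum.Sigma) auto
  also have "\<dots> = (\<Sum>a\<in>c ` set bs. if l a = 1 then 1 else 0)"
  proof (intro sum.cong refl)
    fix a assume "a \<in> c ` set bs"
    then obtain x where "x \<in> set bs" "a = c x" by blast
    then show "(\<Sum>i<l a. \<theta> (w a ^ i)) = (if l a = 1 then 1 else 0)"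
      using P[of x] unfolding P_def by blast
  qed
  also have "\<dots> = of_nat (card {a\<in>c ` set bs. l a = 1})"
    by (simp add: sum.If_cases Int_def)
  also have "card {a\<in>c ` set bs. l a = 1} = card {x\<in>set bs. t x = x}"
  proof (rule bij_betw_same_card[OF bij_betw_imageI, symmetric])
    have fix_iff: "t x = x \<longleftrightarrow> l (c x) = 1" if x: "x \<in> set bs" for x
    proof -
      have "t x = x \<longleftrightarrow> (c (t x), j (t x)) = (c x, j x)"
        using bij x t_in[OF x] by (auto simp: bij_betw_def dest: inj_onD)
      also have "\<dots> \<longleftrightarrow> Suc (j x) mod l (c x) = j x" using c_t[OF x] j_t[OF x] by simp
      also have "\<dots> \<longleftrightarrow> l (c x) = 1"
        using j_less[OF x] by (auto simp: mod_Suc split: if_splits)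
      finally show ?thesis .
    qed
    show "inj_on c {x\<in>set bs. t x = x}"
    proof
      fix x y assume "x \<in> {x\<in>set bs. t x = x}" "y \<in> {x\<in>set bs. t x = x}" "c x = c y"
      then show "x = y"
        using bij j_less[of x] j_less[of y] fix_iff[of x] fix_iff[of y]
        by (auto simp: bij_betw_def inj_on_def)
    qed
    show "c ` {x\<in>set bs. t x = x} = {a\<in>c ` set bs. l a = 1}" using fix_iff by auto
  qed
  finally show ?thesis .
qed

section \<open>Symmetric powers of permutation matrices\<close>

text \<open>Each relevant column has a single nonzero entry, so the substitution sends monomials to
  monomials. This makes the symmetric power of a permutation matrix a permutation matrix
  again.\<close>

lemma sym_image_permutation:
  fixes A :: "'k::field mat"
  assumes A: "dim_row A = n" "\<And>i k. i < n \<Longrightarrow> k < n \<Longrightarrow> A $$ (i, k) = (if h k = i then 1 else 0)"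
    and h: "\<And>k. k < n \<Longrightarrow> h k < n" and "set_mset u \<subseteq> {..<n}"
  shows "sym_image A u = Poly_Mapping.single (image_mset h u) 1"
  using assms(4)
proof (induction u)
  case empty
  show ?case by (simp add: sym_image_def)
next
  case (add k u)
  then have k: "k < n" by simp
  have "(\<Sum>i<n. Poly_Mapping.single {#i#} (A $$ (i, k)))
      = (\<Sum>i<n. if h k = i then Poly_Mapping.single {#i#} 1 else 0)"
    using k A(2) by (intro sum.cong) auto
  also have "\<dots> = Poly_Mapping.single {#h k#} 1" using h[OF k] by simp
  finally have "(\<Sum>i<n. Poly_Mapping.single {#i#} (A $$ (i, k))) = Poly_Mapping.single {#h k#} 1" .
  then show ?case using add A(1) by (simp add: sym_image_def mult_single)
qed

lemma pow_sym_group: "g [^]\<^bsub>sym_group n\<^esub> (k::nat) = g ^^ k"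
proof (induction k)
  case (Suc k)
  then show ?case by (simp add: sym_group_mult funpow_Suc_right del: funpow.simps)
qed (simp add: sym_group_one)

lemma brauer_sym_eq_card_fixed:
  fixes \<theta> :: "'k::field alg_closure \<Rightarrow> complex"
  assumes "Factorial_Ring.prime p" "CHAR('k) = p" "brauer_lift p \<theta>" and g: "g \<in> p_regular p n"
  shows "brauer_sym p \<theta> n r g
    = of_nat (card {u\<in>sym_monomials n r. image_mset (\<lambda>x. g (Suc x) - 1) u = u})"
proof -
  interpret group "sym_group n" by (rule sym_group_is_group)
  \<comment> \<open>\<open>g\<close> transported from \<open>{1..n}\<close> to the variable indices,
    which start at 0.\<close>
  define h where "h = (\<lambda>x. g (Suc x) - 1)"
  define m where "m = ord g"
  have gp: "g permutes {1..n}" and gc: "g \<in> carrier (sym_group n)" and cop: "coprime m p"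
    using g by (auto simp: p_regular_def sym_group_carrier m_def)
  \<comment> \<open>The order 0 stands for infinite order; it is excluded because 0 is not coprime
    to a prime.\<close>
  have "m > 0" using cop \<open>Factorial_Ring.prime p\<close> by (cases m) auto
  have gm: "g ^^ m = id"
    using pow_ord_eq_1[OF gc] by (simp add: m_def pow_sym_group sym_group_one)
  have h_Suc: "Suc (h x) = g (Suc x)" and h_less: "h x < n" if "x < n" for x
    using permutes_in_image[OF gp, of "Suc x"] that by (auto simp: h_def)
  have "(h ^^ i) x < n \<and> Suc ((h ^^ i) x) = (g ^^ i) (Suc x)" if "x < n" for i x
    using that by (induction i) (auto simp: h_less h_Suc)
  from this[of _ m] have hm: "(h ^^ m) x = x" if "x < n" for x using gm that by auto
  define bs where "bs = sym_basis n r"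
  have bs: "distinct bs" "set bs = sym_monomials n r" using sym_basis by (auto simp: bs_def)
  define t where "t = image_mset h"
  have t_pow: "t ^^ i = image_mset (h ^^ i)" for i
    by (induction i) (auto simp: t_def fun_eq_iff image_mset.compositionality o_def)
  have t_m: "(t ^^ m) u = u" if "u \<in> set bs" for u
  proof -
    have "image_mset (h ^^ m) u = image_mset id u"
      using that hm by (intro image_mset_cong) (auto simp: bs sym_monomials_def)
    then show ?thesis by (simp add: t_pow)
  qed
  have t_in: "t u \<in> set bs" if "u \<in> set bs" for u
    using that h_less by (auto simp: bs sym_monomials_def t_def)
  have t_bij: "bij_betw t (set bs) (set bs)"
  proof -
    have "inj_on t (set bs)" by (rule inj_on_if_funpow_id[OF t_m \<open>m > 0\<close>])
    moreover have "t ` set bs \<subseteq> set bs" using t_in by auto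
    ultimately show ?thesis by (simp add: bij_betw_def endo_inj_surj)
  qed
  have "sym_power_mat r (nat_perm_mat n g :: 'k mat)
      = mat (length bs) (length bs) (\<lambda>(i, k). if t (bs ! k) = bs ! i then 1 else 0)"
  proof -
    have "sym_image (nat_perm_mat n g :: 'k mat) (bs ! k) = Poly_Mapping.single (t (bs ! k)) 1"
      if k: "k < length bs" for k
      unfolding t_def
    proof (rule sym_image_permutation)
      show "set_mset (bs ! k) \<subseteq> {..<n}" using k bs nth_mem[OF k] by (auto simp: sym_monomials_def)
      fix i k assume "i < n" "k < n"
      then show "nat_perm_mat n g $$ (i, k) = (if h k = i then 1 else (0 :: 'k))"
        using h_Suc[of k] by (auto simp: nat_perm_mat_def)
    qed (auto simp: nat_perm_mat_def h_less)
    then show ?thesis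
      by (intro eq_matI) (auto simp: sym_power_mat_def nat_perm_mat_def bs_def Let_def lookup_single when_def)
  qed
  then have "brauer_sym p \<theta> n r g = of_nat (card {u\<in>set bs. t u = u})"
    using g brauer_value_permutation[OF assms(1-3) bs(1) t_bij \<open>m > 0\<close> cop t_m]
    by (simp add: brauer_sym_def)
  then show ?thesis by (simp add: bs t_def h_def)
qed

section \<open>Generating functions of fixed monomials\<close>

text \<open>The ground set is a parameter so that \<open>{..<n}\<close> can be cut into invariant
  pieces.\<close>

definition fixed_msets :: "('a \<Rightarrow> 'a) \<Rightarrow> 'a set \<Rightarrow> nat \<Rightarrow> 'a multiset set" where
  "fixed_msets h A r = {u. set_mset u \<subseteq> A \<and> size u = r \<and> image_mset h u = u}"

definition fixed_gf :: "('a \<Rightarrow> 'a) \<Rightarrow> 'a set \<Rightarrow> complex fps" where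
  "fixed_gf h A = Abs_fps (\<lambda>r. of_nat (card (fixed_msets h A r)))"

lemma finite_fixed_msets:
  assumes "finite A" shows "finite (fixed_msets h A r)"
proof (rule finite_subset)
  show "fixed_msets h A r \<subseteq> mset ` {xs. set xs \<subseteq> A \<and> length xs = r}"
  proof
    fix u assume u: "u \<in> fixed_msets h A r"
    obtain xs where "mset xs = u" using ex_mset by blast
    with u show "u \<in> mset ` {xs. set xs \<subseteq> A \<and> length xs = r}"
      by (auto simp: fixed_msets_def)
  qed
qed (simp add: finite_lists_length_eq[OF assms])

text \<open>A fixed multiset splits uniquely into its parts on \<open>A\<close> and on
  \<open>B\<close>, and both parts are fixed because \<open>h\<close> preserves both sets. Sorting
  by the size of the part on \<open>A\<close> gives the Cauchy product.\<close>

lemma fixed_gf_Un: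
  assumes fin: "finite A" "finite B" and disj: "A \<inter> B = {}"
    and h: "h ` A \<subseteq> A" "h ` B \<subseteq> B"
  shows "fixed_gf h (A \<union> B) = fixed_gf h A * fixed_gf h B"
proof (rule fps_ext)
  fix r
  let ?P = "Sigma {0..r} (\<lambda>i. fixed_msets h A i \<times> fixed_msets h B (r - i))"
  let ?inA = "filter_mset (\<lambda>x. x \<in> A)" and ?notA = "filter_mset (\<lambda>x. x \<notin> A)"
  have fixed_filter: "image_mset h (?inA u) = ?inA u \<and> image_mset h (?notA u) = ?notA u"
    if u: "u \<in> fixed_msets h (A \<union> B) r" for u
  proof -
    have sub: "set_mset u \<subseteq> A \<union> B" and fixed: "image_mset h u = u"
      using u by (auto simp: fixed_msets_def)
    \<comment> \<open>Disjointness gives the converse direction: points of \<open>B\<close> stay in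
      \<open>B\<close>, hence outside \<open>A\<close>.\<close>
    have "h x \<in> A \<longleftrightarrow> x \<in> A" if "x \<in># u" for x using that sub h disj by blast
    then have "filter_mset (\<lambda>x. h x \<in> A) u = ?inA u" "filter_mset (\<lambda>x. h x \<notin> A) u = ?notA u"
      by (auto intro!: filter_mset_cong)
    then show ?thesis
      using filter_mset_image_mset[of "\<lambda>x. x \<in> A" h u] filter_mset_image_mset[of "\<lambda>x. x \<notin> A" h u]
      by (simp add: fixed)
  qed
  have "bij_betw (\<lambda>(i, u, v). u + v) ?P (fixed_msets h (A \<union> B) r)"
  proof (rule bij_betw_byWitness[where f' = "\<lambda>u. (size (?inA u), ?inA u, ?notA u)"])
    show "\<forall>x\<in>?P. (\<lambda>u. (size (?inA u), ?inA u, ?notA u)) (case x of (i, u, v) \<Rightarrow> u + v) = x"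
    proof
      fix x assume "x \<in> ?P"
      then obtain i u v where x: "x = (i, u, v)"
        and "u \<in> fixed_msets h A i" "v \<in> fixed_msets h B (r - i)" by blast
      then have "set_mset u \<subseteq> A" "set_mset v \<subseteq> B" "size u = i" by (auto simp: fixed_msets_def)
      moreover from this have "?inA u = u" "?inA v = {#}" "?notA u = {#}" "?notA v = v"
        using disj by (auto simp: filter_mset_eq_conv)
      ultimately show "(\<lambda>u. (size (?inA u), ?inA u, ?notA u)) (case x of (i, u, v) \<Rightarrow> u + v) = x"
        by (simp add: x)
    qed
    show "\<forall>u\<in>fixed_msets h (A \<union> B) r. (case (size (?inA u), ?inA u, ?notA u) of (i, u, v) \<Rightarrow> u + v) = u"
      by simp
    show "(\<lambda>(i, u, v). u + v) ` ?P \<subseteq> fixed_msets h (A \<union> B) r"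
      by (auto simp: fixed_msets_def)
    show "(\<lambda>u. (size (?inA u), ?inA u, ?notA u)) ` fixed_msets h (A \<union> B) r \<subseteq> ?P"
    proof (rule image_subsetI)
      fix u assume u: "u \<in> fixed_msets h (A \<union> B) r"
      then have "size (?inA u) + size (?notA u) = r"
        by (simp add: fixed_msets_def flip: size_union)
      with u fixed_filter[OF u] show "(size (?inA u), ?inA u, ?notA u) \<in> ?P"
        by (auto simp: fixed_msets_def)
    qed
  qed
  then have "card (fixed_msets h (A \<union> B) r) = card ?P" by (simp add: bij_betw_same_card)
  also have "\<dots> = (\<Sum>i=0..r. card (fixed_msets h A i) * card (fixed_msets h B (r - i)))"
    using fin by (simp add: finite_fixed_msets card_cartesian_product)
  finally show "fixed_gf h (A \<union> B) $ r = (fixed_gf h A * fixed_gf h B) $ r"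
    by (simp add: fixed_gf_def fps_mult_nth)
qed

text \<open>Cycles on intervals of consecutive numbers suffice, since one permutation of each cycle
  type is enough.\<close>

definition cycles_block :: "(nat \<Rightarrow> nat) \<Rightarrow> nat \<Rightarrow> nat \<Rightarrow> bool" where
  "cycles_block h b d \<longleftrightarrow> (\<forall>i<d. h (b + i) = b + Suc i mod d)"

lemma cycles_block_image: "cycles_block h b d \<Longrightarrow> h ` {b..<b + d} \<subseteq> {b..<b + d}"
  by (auto simp: cycles_block_def nat_le_iff_add)

lemma cycles_block_funpow:
  assumes "cycles_block h b d" "i < d"
  shows "(h ^^ m) (b + i) = b + (i + m) mod d"
proof (induction m)
  case (Suc m)
  have "(i + m) mod d < d" using assms(2) by simp
  then show ?case using Suc assms(1) by (simp add: cycles_block_def mod_Suc_eq)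
qed (use assms in simp)

text \<open>A multiset fixed by a \<open>d\<close>-cycle has constant multiplicity, so there is
  exactly one of size \<open>r\<close> if \<open>d\<close> divides \<open>r\<close> and none
  otherwise: a geometric series.\<close>

lemma fixed_gf_cycle:
  assumes h: "cycles_block h b d" and "d > 0"
  shows "fixed_gf h {b..<b + d} * (1 - fps_X ^ d) = 1"
proof -
  let ?A = "{b..<b + d}"
  have inj: "inj_on h ?A"
  proof (rule inj_on_if_funpow_id[OF _ \<open>d > 0\<close>])
    show "(h ^^ d) z = z" if "z \<in> ?A" for z
      using cycles_block_funpow[OF h, of "z - b" d] that by auto
  qed
  have const: "u = repeat_mset (count u b) (mset_set ?A)"
    if u: "set_mset u \<subseteq> ?A" "image_mset h u = u" for u
  proof (rule multiset_eqI)
    \<comment> \<open>Multiplicities in the image are sums over fibres; by injectivity the fibre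
      over \<open>h x\<close> within \<open>u\<close> is at most \<open>x\<close> itself.\<close>
    have step: "count u (h x) = count u x" if "x \<in> ?A" for x
    proof -
      have "count u (h x) = count (image_mset h u) (h x)" by (simp add: u(2))
      also have "\<dots> = (\<Sum>y | y \<in># u \<and> h x = h y. count u y)" by (rule count_image_mset')
      also have "{y. y \<in># u \<and> h x = h y} = (if x \<in># u then {x} else {})"
        using that u(1) inj by (auto dest: inj_onD)
      also have "(\<Sum>y\<in>(if x \<in># u then {x} else {}). count u y) = count u x"
        by (auto simp: not_in_iff)
      finally show ?thesis .
    qed
    have count_eq: "count u (b + i) = count u b" if "i < d" for i
      using that
    proof (induction i)
      case (Suc i)
      then show ?case using step[of "b + i"] h by (simp add: cycles_block_def)
    qed simp
    show "count u x = count (repeat_mset (count u b) (mset_set ?A)) x" for x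
    proof (cases "x \<in> ?A")
      case True
      then show ?thesis using count_eq[of "x - b"] by auto
    next
      case False
      then have "x \<notin># u" using u(1) by blast
      then show ?thesis using False by (simp add: not_in_iff)
    qed
  qed
  have image: "image_mset h (mset_set ?A) = mset_set ?A"
  proof -
    have "h ` ?A = ?A"
      using cycles_block_image[OF h] inj by (intro endo_inj_surj) auto
    then show ?thesis using image_mset_mset_set[OF inj] by simp
  qed
  have fixed: "fixed_msets h ?A r = (if d dvd r then {repeat_mset (r div d) (mset_set ?A)} else {})" for r
  proof (intro Set.set_eqI iffI)
    fix u assume "u \<in> fixed_msets h ?A r"
    then have u: "set_mset u \<subseteq> ?A" "image_mset h u = u" "size u = r" by (auto simp: fixed_msets_def)
    have "r = count u b * d"
      using arg_cong[OF const[OF u(1,2)], of size] u(3) by simp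
    then show "u \<in> (if d dvd r then {repeat_mset (r div d) (mset_set ?A)} else {})"
      using const[OF u(1,2)] \<open>d > 0\<close> by simp
  next
    have "image_mset h (repeat_mset q (mset_set ?A)) = repeat_mset q (mset_set ?A)" for q
      by (induction q) (auto simp: image)
    moreover have "set_mset (repeat_mset q (mset_set ?A)) \<subseteq> ?A" for q
      by (induction q) auto
    moreover fix u assume "u \<in> (if d dvd r then {repeat_mset (r div d) (mset_set ?A)} else {})"
    ultimately show "u \<in> fixed_msets h ?A r" by (auto simp: fixed_msets_def split: if_splits)
  qed
  have gf: "fixed_gf h ?A = Abs_fps (\<lambda>r. if d dvd r then 1 else 0)"
    unfolding fixed_gf_def fixed by (intro fps_ext) simp
  show ?thesis
  proof (rule fps_ext)
    fix r
    \<comment> \<open>For \<open>r < d\<close> the product has the coefficient of the series,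
      nonzero only at \<open>r = 0\<close>. For larger \<open>r\<close> it is the difference of the
      coefficients at \<open>r\<close> and \<open>r - d\<close>, which agree.\<close>
    show "(fixed_gf h ?A * (1 - fps_X ^ d)) $ r = (1 :: complex fps) $ r"
    proof (cases "r < d")
      case True
      then show ?thesis by (auto simp: gf algebra_simps fps_X_power_mult_nth fps_X_power_mult_right_nth dest: dvd_imp_le)
    next
      case False
      then show ?thesis using \<open>d > 0\<close> by (auto simp: gf dvd_minus_self algebra_simps fps_X_power_mult_nth fps_X_power_mult_right_nth)
    qed
  qed
qed

text \<open>The induction splits off the last block. Invariance is carried along because
  \<open>fixed_gf_Un\<close> requires it.\<close>

lemma fixed_gf_cycles:
  assumes "\<And>i. i < k \<Longrightarrow> cycles_block h (a + d * i) d" and "d > 0"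
  shows "h ` {a..<a + d * k} \<subseteq> {a..<a + d * k} \<and> fixed_gf h {a..<a + d * k} * (1 - fps_X ^ d) ^ k = 1"
  using assms(1)
proof (induction k)
  case 0
  have "fixed_msets h {} r = (if r = 0 then {{#}} else {})" for r
    by (auto simp: fixed_msets_def)
  then have "fixed_gf h {} = 1" by (intro fps_ext) (simp add: fixed_gf_def)
  then show ?case by simp
next
  case (Suc k)
  let ?A = "{a..<a + d * k}" and ?B = "{a + d * k..<a + d * k + d}"
  have split: "{a..<a + d * Suc k} = ?A \<union> ?B" by auto
  have block: "cycles_block h (a + d * k) d" using Suc.prems by simp
  have IH: "h ` ?A \<subseteq> ?A" "fixed_gf h ?A * (1 - fps_X ^ d) ^ k = 1" using Suc by auto
  have "fixed_gf h (?A \<union> ?B) = fixed_gf h ?A * fixed_gf h ?B"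
    by (rule fixed_gf_Un) (use IH(1) cycles_block_image[OF block] in auto)
  then have "fixed_gf h (?A \<union> ?B) * (1 - fps_X ^ d) ^ Suc k
      = (fixed_gf h ?A * (1 - fps_X ^ d) ^ k) * (fixed_gf h ?B * (1 - fps_X ^ d))"
    by (simp add: mult_ac)
  also have "\<dots> = 1" using IH(2) fixed_gf_cycle[OF block \<open>d > 0\<close>] by simp
  finally show ?case using IH(1) cycles_block_image[OF block] unfolding split by blast
qed

section \<open>Linear independence\<close>

text \<open>Take the lexicographically largest \<^term>\<open>(d, k)\<close> with nonzero coefficient. Multiplication by \<open>M\<close>
  clears all denominators, and every other term becomes divisible by \<open>1 - x ^ d\<close>; so evaluation at a
  primitive \<open>d\<close>-th root of unity isolates the coefficient.\<close>

lemma pole_orders_independent: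
  fixes f :: "nat \<times> nat \<Rightarrow> complex fps"
  assumes "finite I"
    and I: "\<And>d k. (d, k) \<in> I \<Longrightarrow> d * k \<le> n \<and> (d = 1 \<and> k = 0 \<or> d \<ge> 2 \<and> k \<ge> 1)"
    and f: "\<And>d k. (d, k) \<in> I \<Longrightarrow> f (d, k) * ((1 - fps_X ^ d) ^ k * (1 - fps_X) ^ (n - d * k)) = 1"
    and sum0: "(\<Sum>i\<in>I. fps_const (c i) * f i) = 0"
    and "i \<in> I"
  shows "c i = 0"
proof (rule ccontr)
  assume "c i \<noteq> 0"
  define J where "J = {i\<in>I. c i \<noteq> 0}"
  have J: "finite J" "J \<noteq> {}" "J \<subseteq> I" 
    unfolding J_def using \<open>finite I\<close> \<open>i \<in> I\<close> \<open>c i \<noteq> 0\<close> by (simp, blast, blast)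
  have sumJ: "(\<Sum>i\<in>J. fps_const (c i) * f i) = 0"
    using sum.mono_neutral_left[OF \<open>finite I\<close> J(3), of "\<lambda>i. fps_const (c i) * f i"] sum0
    by (auto simp: J_def)
  define d where "d = Max (fst ` J)"
  define k where "k = Max {k. (d, k) \<in> J}"
  have fin_k: "finite {k. (d, k) \<in> J}"
    using finite_imageI[OF J(1), of snd] by (rule rev_finite_subset) force
  have "d \<in> fst ` J" unfolding d_def using J by (intro Max_in) auto
  then have ne: "{k. (d, k) \<in> J} \<noteq> {}" by auto
  have dk: "(d, k) \<in> J" using Max_in[OF fin_k ne] by (simp add: k_def)
  have d_max: "e \<le> d" if "(e, m) \<in> J" for e m
    unfolding d_def using that J(1) by (intro Max_ge) force+
  have k_max: "m \<le> k" if "(d, m) \<in> J" for m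
    unfolding k_def using that fin_k by (intro Max_ge) auto
  show False
  proof (cases "d = 1")
    case True
    \<comment> \<open>With \<open>d = 1\<close> maximal, only the index \<open>(1, 0)\<close> of the
      identity can remain.\<close>
    have "i = (d, k)" if "i \<in> J" for i
      using that J(3) I[of "fst i" "snd i"] I[of d k] dk d_max[of "fst i" "snd i"] True
      by (cases i) auto
    then have "J = {(d, k)}" using dk by blast
    then have "fps_const (c (d, k)) * f (d, k) = 0" using sumJ by simp
    moreover have "f (d, k) \<noteq> 0" using f[of d k] dk J(3) by auto
    ultimately show False using dk by (auto simp: J_def)
  next
    case False
    then have d2: "d \<ge> 2" "k \<ge> 1" and dkn: "d * k \<le> n" using I[of d k] dk J(3) by auto
    define x :: "complex poly" where "x = [:0, 1:]"
    define den where "den = (\<lambda>(e, m). (1 - x ^ e) ^ m * (1 - x) ^ (n - e * m))"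
    \<comment> \<open>The exponent \<open>n\<close> dominates every \<open>m\<close> that occurs
      with some \<open>e \<ge> 2\<close>, since \<open>e * m \<le> n\<close>.\<close>
    define Q where "Q = (\<Prod>e\<in>{2..<d}. (1 - x ^ e) ^ n)"
    define M where "M = (1 - x ^ d) ^ k * (Q * (1 - x) ^ n)"
    have fps_den: "f i * fps_of_poly (den i) = 1" if "i \<in> J" for i
      using f[of "fst i" "snd i"] that J(3)
      by (auto simp: den_def x_def fps_of_poly_mult fps_of_poly_power fps_of_poly_diff split: prod.splits)
    have lead: "M = den (d, k) * (Q * (1 - x) ^ (d * k))"
    proof -
      have "(1 - x) ^ n = (1 - x) ^ (n - d * k) * (1 - x) ^ (d * k)"
        using dkn by (simp flip: power_add)
      then show ?thesis by (simp add: M_def den_def mult_ac)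
    qed
    have other: "(1 - x ^ d) * den i dvd M" if i: "i \<in> J - {(d, k)}" for i
    proof -
      obtain e m where em: "i = (e, m)" by (cases i)
      have emJ: "(e, m) \<in> J" and em_ne: "(e, m) \<noteq> (d, k)" using i em by auto
      have emI: "e * m \<le> n" "e = 1 \<and> m = 0 \<or> e \<ge> 2 \<and> m \<ge> 1" using I[of e m] emJ J(3) by auto
      have x_dvd: "(1 - x) ^ (n - e * m) dvd (1 - x) ^ n" by (rule le_imp_power_dvd) simp
      have d_dvd: "1 - x ^ d dvd (1 - x ^ d) ^ k" using d2 by (intro dvd_power) simp
      \<comment> \<open>If \<open>e = d\<close>, then \<open>m < k\<close> leaves a spare factor
        \<open>1 - x ^ d\<close> in \<open>M\<close>. If \<open>e < d\<close>, then \<open>Q\<close>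
        absorbs the denominator and \<open>(1 - x ^ d) ^ k\<close> is left untouched.\<close>
      consider "e = d" | "e < d" using d_max[OF emJ] by linarith
      then show ?thesis
      proof cases
        case 1
        then have "m < k" using k_max emJ em_ne by (metis le_neq_implies_less)
        then have "(1 - x ^ d) ^ Suc m dvd (1 - x ^ d) ^ k" by (intro le_imp_power_dvd) simp
        moreover have "(1 - x) ^ (n - e * m) dvd Q * (1 - x) ^ n" using x_dvd by (rule dvd_mult)
        ultimately have "(1 - x ^ d) ^ Suc m * (1 - x) ^ (n - e * m) dvd M"
          unfolding M_def by (rule mult_dvd_mono)
        then show ?thesis using 1 by (simp add: em den_def mult_ac)
      next
        case 2
        have "(1 - x ^ e) ^ m dvd Q"
        proof (cases "m = 0")
          case False
          with emI have "e \<ge> 2" "m \<le> n" by (auto intro: order_trans[rotated])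
          then have "(1 - x ^ e) ^ m dvd (1 - x ^ e) ^ n" by (intro le_imp_power_dvd)
          also have "\<dots> dvd Q" unfolding Q_def using 2 \<open>e \<ge> 2\<close> by (intro dvd_prodI) auto
          finally show ?thesis .
        qed simp
        then show ?thesis unfolding em den_def M_def prod.case
          by (intro mult_dvd_mono d_dvd x_dvd)
      qed
    qed
    then have "\<forall>i\<in>J - {(d, k)}. \<exists>r. M = (1 - x ^ d) * den i * r" by (auto simp: dvd_def)
    then obtain r where r: "\<And>i. i \<in> J - {(d, k)} \<Longrightarrow> M = (1 - x ^ d) * den i * r i" by metis
    have f_M: "f i * fps_of_poly M = fps_of_poly ((1 - x ^ d) * r i)" if "i \<in> J - {(d, k)}" for i
    proof -
      have "f i * fps_of_poly M = (f i * fps_of_poly (den i)) * fps_of_poly ((1 - x ^ d) * r i)"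
        by (subst r[OF that]) (simp add: fps_of_poly_mult mult_ac)
      also have "f i * fps_of_poly (den i) = 1" using fps_den that by blast
      finally show ?thesis by simp
    qed
    have f_lead: "f (d, k) * fps_of_poly M = fps_of_poly (Q * (1 - x) ^ (d * k))"
    proof -
      have "f (d, k) * fps_of_poly M = (f (d, k) * fps_of_poly (den (d, k))) * fps_of_poly (Q * (1 - x) ^ (d * k))"
        by (subst lead) (simp add: fps_of_poly_mult mult_ac)
      also have "f (d, k) * fps_of_poly (den (d, k)) = 1" using fps_den dk by blast
      finally show ?thesis by simp
    qed
    \<comment> \<open>Multiplying the relation by \<open>M\<close> turns it into an identity of
      polynomials, which unlike power series can be evaluated at a point of the unit circle.\<close>
    have "fps_of_poly (Polynomial.smult (c (d, k)) (Q * (1 - x) ^ (d * k))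
        + (\<Sum>i\<in>J - {(d, k)}. Polynomial.smult (c i) ((1 - x ^ d) * r i)))
      = (\<Sum>i\<in>J. fps_const (c i) * (f i * fps_of_poly M))"
      using J(1) dk f_M f_lead
      by (simp add: fps_of_poly_add fps_of_poly_sum fps_of_poly_smult sum.remove[of J "(d, k)"])
    also have "\<dots> = (\<Sum>i\<in>J. fps_const (c i) * f i) * fps_of_poly M"
      by (simp add: sum_distrib_right mult.assoc)
    also have "\<dots> = fps_of_poly 0" using sumJ by simp
    finally have poly0: "Polynomial.smult (c (d, k)) (Q * (1 - x) ^ (d * k))
        + (\<Sum>i\<in>J - {(d, k)}. Polynomial.smult (c i) ((1 - x ^ d) * r i)) = 0"
      by (simp only: fps_of_poly_eq_iff)
    obtain z :: complex where z: "z ^ d = 1" "\<And>i. 0 < i \<Longrightarrow> i < d \<Longrightarrow> z ^ i \<noteq> 1"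
      using ex_primitive_root_of_unity_complex[of d] d2 by auto
    have "c (d, k) * (poly Q z * (1 - z) ^ (d * k)) = 0"
      using arg_cong[OF poly0, of "\<lambda>p. poly p z"] z(1) by (simp add: poly_sum x_def)
    \<comment> \<open>Primitivity of \<open>z\<close> keeps the cofactor of the leading coefficient
      away from 0.\<close>
    moreover have "1 - z \<noteq> 0" using z(2)[of 1] d2 by auto
    moreover have "poly Q z \<noteq> 0" using z(2) by (auto simp: Q_def x_def poly_prod)
    ultimately show False using dk by (auto simp: J_def)
  qed
qed

section \<open>The lower bound\<close>

lemma divide_minus_one_le_div: "real n / real d - 1 \<le> real (n div d)"
  using floor_divide_of_nat_eq[where 'a = real, of n d] by linarith

text \<open>\<open>harm n - ln n\<close> decreases to its limit, so each term is at least the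
  limit.\<close>

lemma harm_ge_ln_plus_euler_mascheroni:
  assumes "n \<ge> 1" shows "ln (real n) + euler_mascheroni \<le> harm n"
proof -
  obtain m where n: "n = Suc m" using assms by (cases n) auto
  have "(\<lambda>n. harm (Suc n) - ln (real (Suc n))) \<longlonglongrightarrow> euler_mascheroni"
    using LIMSEQ_Suc[OF euler_mascheroni_LIMSEQ] by simp
  from decseq_ge[OF decseq_harm_diff_ln this, of m] show ?thesis by (simp add: n)
qed

text \<open>Weakens \<open>euler_mascheroni_lower\<close> by dropping its positive correction
  term.\<close>

lemma harm_le_ln_Suc_plus_euler_mascheroni:
  assumes "m \<ge> 1" shows "harm m \<le> ln (real (Suc m)) + euler_mascheroni"
proof -
  obtain k where "m = Suc k" using assms by (cases m) auto
  moreover have "1 / real (2 * (k + 2)) \<ge> 0" by simp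
  ultimately show ?thesis
    using euler_mascheroni_lower[of k] unfolding \<open>m = Suc k\<close> add_2_eq_Suc' by linarith
qed

text \<open>The multiples of \<open>p\<close> are the \<open>p * k\<close> with
  \<open>k \<le> n div p\<close>; they contribute \<open>1 / p\<close> times a shorter harmonic
  sum.\<close>

lemma sum_inverse_not_dvd:
  assumes "p \<ge> (1::nat)"
  shows "(\<Sum>d\<in>{d\<in>{1..n}. \<not> p dvd d}. 1 / real d) = harm n - harm (n div p) / real p"
proof -
  have "harm n = (\<Sum>d\<in>{d\<in>{1..n}. \<not> p dvd d}. 1 / real d) + (\<Sum>d\<in>{d\<in>{1..n}. p dvd d}. 1 / real d)"
    unfolding harm_def by (subst sum.union_disjoint [symmetric])
      (auto intro!: sum.cong simp: divide_inverse)
  also have "(\<Sum>d\<in>{d\<in>{1..n}. p dvd d}. 1 / real d) = (\<Sum>k\<in>{1..n div p}. 1 / real (p * k))"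
  proof (rule sum.reindex_bij_witness[of _ "\<lambda>k. p * k" "\<lambda>d. d div p"])
    fix k assume "k \<in> {1..n div p}"
    then show "p * k \<in> {d \<in> {1..n}. p dvd d}"
      using assms by (auto simp: less_eq_div_iff_mult_less_eq mult.commute)
  qed (use assms in \<open>auto simp: div_le_mono div_greater_zero_iff Suc_le_eq less_eq_div_iff_mult_less_eq mult.commute elim!: dvdE\<close>)
  also have "\<dots> = harm (n div p) / real p"
    by (simp add: harm_def sum_divide_distrib inverse_eq_divide mult.commute)
  finally show ?thesis by simp
qed

lemma card_not_dvd:
  assumes "p \<ge> (1::nat)"
  shows "card {d\<in>{1..n}. \<not> p dvd d} = n - n div p"
proof -
  have "card {d\<in>{1..n}. p dvd d} = n div p"
  proof (subst bij_betw_same_card[of "\<lambda>d. d div p" _ "{1..n div p}"])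
    show "bij_betw (\<lambda>d. d div p) {d \<in> {1..n}. p dvd d} {1..n div p}"
    proof (rule bij_betw_byWitness[where f' = "\<lambda>k. p * k"])
      show "(*) p ` {1..n div p} \<subseteq> {d \<in> {1..n}. p dvd d}"
        using assms by (auto simp: less_eq_div_iff_mult_less_eq mult.commute)
    qed (use assms in \<open>auto simp: div_le_mono div_greater_zero_iff Suc_le_eq less_eq_div_iff_mult_less_eq mult.commute elim!: dvdE\<close>)
  qed simp
  moreover have "{d\<in>{1..n}. \<not> p dvd d} = {1..n} - {d\<in>{1..n}. p dvd d}" (is "?A = _ - ?B") by auto
  moreover have "card ({1..n} - ?B) = card {1..n} - card ?B"
    by (rule card_Diff_subset) auto
  ultimately show ?thesis by (metis card_atLeastAtMost diff_Suc_1)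
qed

text \<open>Including \<open>d = 1\<close> completes the harmonic sum at the cost of
  \<open>n\<close>. Rounding down each quotient costs at most 1, in total
  \<open>card D \<le> 1 + n - n / p\<close>, and the leading summand 1 of the claim pays for the 1
  in this bound.\<close>

lemma sum_div_not_dvd_ge:
  fixes n p :: nat
  assumes "p \<ge> 2" "n \<ge> 1"
  shows "real (1 + (\<Sum>d\<in>{d\<in>{2..n}. \<not> p dvd d}. n div d)) \<ge>
    (real p - 1) / real p * real n * ln (real n) +
    real n * (euler_mascheroni - 1 - (real p - 1) / real p - euler_mascheroni / real p)"
proof -
  define D where "D = {d\<in>{1..n}. \<not> p dvd d}"
  define L where "L = ln (real n) + euler_mascheroni"
  have fin: "finite D" by (simp add: D_def)
  have L0: "L \<ge> 0" using assms euler_mascheroni_pos by (simp add: L_def)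
  \<comment> \<open>The same \<open>L\<close> bounds both harmonic sums, which produces the factor
    \<open>1 - 1 / p\<close>. For \<open>q = n div p \<ge> 1\<close>, \<open>p \<ge> 2\<close> gives
    \<open>q + 1 \<le> p * q \<le> n\<close>, so \<open>ln (q + 1)\<close> is at most
    \<open>ln n\<close>.\<close>
  have hm: "harm (n div p) \<le> L"
  proof (cases "n div p = 0")
    case True
    then show ?thesis using L0 by (simp add: harm_def)
  next
    case False
    then have q: "n div p \<ge> 1" by simp
    have "Suc (n div p) \<le> p * (n div p)"
      using mult_le_mono1[OF assms(1), of "n div p"] q by linarith
    also have "\<dots> \<le> n" by simp
    finally have "ln (real (Suc (n div p))) \<le> ln (real n)" by simp
    then show ?thesis
      using harm_le_ln_Suc_plus_euler_mascheroni[OF q] unfolding L_def by linarith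
  qed
  have D1: "D = insert 1 {d\<in>{2..n}. \<not> p dvd d}" using assms by (auto simp: D_def)
  have "(\<Sum>d\<in>D. n div d) = n + (\<Sum>d\<in>{d\<in>{2..n}. \<not> p dvd d}. n div d)"
    unfolding D1 by (subst sum.insert) auto
  then have split: "real (1 + (\<Sum>d\<in>{d\<in>{2..n}. \<not> p dvd d}. n div d)) = 1 - real n + real (\<Sum>d\<in>D. n div d)"
    by simp
  have "real n * (\<Sum>d\<in>D. 1 / real d) - real (card D) = (\<Sum>d\<in>D. real n / real d - 1)"
    by (simp add: sum_subtractf sum_distrib_left)
  also have "\<dots> \<le> (\<Sum>d\<in>D. real (n div d))"
  proof (rule sum_mono)
    fix d assume "d \<in> D"
    show "real n / real d - 1 \<le> real (n div d)" by (rule divide_minus_one_le_div)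
  qed
  finally have A: "real n * (harm n - harm (n div p) / real p) - real (card D) \<le> real (\<Sum>d\<in>D. n div d)"
    using sum_inverse_not_dvd[of p n, folded D_def] assms by simp
  have B: "real n * (L - L / real p) \<le> real n * (harm n - harm (n div p) / real p)"
  proof (intro mult_left_mono diff_mono divide_right_mono)
    show "L \<le> harm n" unfolding L_def by (rule harm_ge_ln_plus_euler_mascheroni[OF assms(2)])
  qed (use hm in auto)
  have "real (card D) = real n - real (n div p)"
    using card_not_dvd[of p n, folded D_def] assms by (simp add: of_nat_diff div_le_dividend)
  moreover have "real n / real p - 1 \<le> real (n div p)"  by (rule divide_minus_one_le_div)
  ultimately have C: "real (card D) \<le> 1 + real n - real n / real p" by linarith
  have "real n * (L - L / real p) - real n - (real n - real n / real p)
      \<le> real (1 + (\<Sum>d\<in>{d\<in>{2..n}. \<not> p dvd d}. n div d))"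
    using A B C split by linarith
  moreover have "real n * (L - L / real p) - real n - (real n - real n / real p) =
    (real p - 1) / real p * real n * ln (real n) +
    real n * (euler_mascheroni - 1 - (real p - 1) / real p - euler_mascheroni / real p)"
    using assms by (simp add: L_def field_simps)
  ultimately show ?thesis by simp
qed

section \<open>Permutations of cycle type (d^k, 1^(n - dk))\<close>

definition block_rotation :: "nat \<Rightarrow> nat \<Rightarrow> nat \<Rightarrow> nat" where
  "block_rotation d k x = (if x < d * k then d * (x div d) + Suc x mod d else x)"

lemma block_rotation_less:
  assumes "d > 0" "d * k \<le> n" "x < n" shows "block_rotation d k x < n"
proof (cases "x < d * k")
  case True
  then have "Suc (x div d) \<le> k" using assms(1) by (simp add: Suc_le_eq less_mult_imp_div_less mult.commute)
  then have "d * Suc (x div d) \<le> d * k" by (rule mult_le_mono2)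
  moreover have "Suc x mod d < d" using assms(1) by simp
  ultimately have "d * (x div d) + Suc x mod d < d * k" by simp
  then show ?thesis using True assms(2) by (simp add: block_rotation_def)
qed (use assms in \<open>simp add: block_rotation_def\<close>)

lemma cycles_block_block_rotation:
  assumes "i < k" shows "cycles_block (block_rotation d k) (d * i) d"
  unfolding cycles_block_def
proof (intro allI impI)
  fix j assume j: "j < d"
  have "d * i + j < d * Suc i" using j by simp
  also have "\<dots> \<le> d * k" using assms by (intro mult_le_mono2) simp
  finally have "d * i + j < d * k" .
  moreover have "(d * i + j) div d = i" using j by simp
  moreover have "Suc (d * i + j) mod d = Suc j mod d" by (metis add_Suc_right mod_mult_self4)
  ultimately show "block_rotation d k (d * i + j) = d * i + Suc j mod d"
    by (simp add: block_rotation_def)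
qed

lemma block_rotation_funpow_id:
  assumes "d > 0" shows "(block_rotation d k ^^ d) x = x"
proof (cases "x < d * k")
  case True
  then have "x div d < k" using assms by (simp add: less_mult_imp_div_less mult.commute)
  then have "(block_rotation d k ^^ d) (d * (x div d) + x mod d)
      = d * (x div d) + (x mod d + d) mod d"
    using assms by (intro cycles_block_funpow cycles_block_block_rotation) auto
  then show ?thesis by simp
next
  case False
  then have "(block_rotation d k ^^ m) x = x" for m
    by (induction m) (auto simp: block_rotation_def)
  then show ?thesis .
qed

text \<open>The witness is \<open>block_rotation d k\<close>, moved to \<open>{1..n}\<close>. Its
  \<open>d\<close>-th power is the identity, so its order divides \<open>d\<close> and is prime to
  \<open>p\<close>.\<close>

lemma ex_p_regular_fixed_gf:
  assumes "d > 0" "d * k \<le> n" "coprime d p"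
  obtains g where "g \<in> p_regular p n"
    and "fixed_gf (\<lambda>x. g (Suc x) - 1) {..<n} * ((1 - fps_X ^ d) ^ k * (1 - fps_X) ^ (n - d * k)) = 1"
proof
  interpret group "sym_group n" by (rule sym_group_is_group)
  let ?b = "block_rotation d k"
  define g where "g y = (if y \<in> {1..n} then Suc (?b (y - 1)) else y)" for y
  have g_in: "g y \<in> {1..n}" if "y \<in> {1..n}" for y
    using block_rotation_less[OF assms(1,2), of "y - 1"] that by (force simp: g_def Suc_le_eq)
  have pow: "(g ^^ i) y \<in> {1..n} \<and> (g ^^ i) y = Suc ((?b ^^ i) (y - 1))" if "y \<in> {1..n}" for i y
  proof (induction i)
    case (Suc i)
    then have "g ((g ^^ i) y) = Suc (?b ((g ^^ i) y - 1))" unfolding g_def by auto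
    moreover have "g ((g ^^ i) y) \<in> {1..n}" using Suc g_in by blast
    ultimately show ?case using Suc by simp
  qed (use that in auto)
  have pow_id: "(g ^^ d) y = y" for y
  proof (cases "y \<in> {1..n}")
    case True
    then show ?thesis using pow[OF True, of d] block_rotation_funpow_id[OF assms(1)] by simp
  next
    case False
    then have "(g ^^ i) y = y" for i by (induction i) (auto simp: g_def)
    then show ?thesis .
  qed
  have "inj_on g {1..n}" by (rule inj_on_if_funpow_id[OF pow_id assms(1)])
  moreover have "g ` {1..n} = {1..n}"
    using calculation g_in by (intro endo_inj_surj) auto
  ultimately have "g permutes {1..n}"
    by (intro bij_imp_permutes) (auto simp: bij_betw_def g_def)
  then have gc: "g \<in> carrier (sym_group n)" by (simp add: sym_group_carrier)
  have "g [^]\<^bsub>sym_group n\<^esub> d = \<one>\<^bsub>sym_group n\<^esub>"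
    using pow_id by (auto simp: pow_sym_group sym_group_one)
  then have "ord g dvd d" using pow_eq_id[OF gc] by simp
  then have "coprime (ord g) p" using coprime_divisors[OF _ dvd_refl assms(3)] by blast
  then show "g \<in> p_regular p n" using gc by (simp add: p_regular_def)
  let ?h = "\<lambda>x. g (Suc x) - 1"
  have h: "?h x = ?b x" if "x < n" for x using that by (simp add: g_def)
  have blocks: "cycles_block ?h (0 + d * i) d" if "i < k" for i
    unfolding cycles_block_def
  proof (intro allI impI)
    fix j assume "j < d"
    then have "d * i + j < d * Suc i" by simp
    also have "\<dots> \<le> d * k" using that by (intro mult_le_mono2) simp
    finally have "?h (d * i + j) = ?b (d * i + j)" using assms(2) by (intro h) simp
    then show "?h (0 + d * i + j) = 0 + d * i + Suc j mod d"
      using cycles_block_block_rotation[OF that, of d] \<open>j < d\<close> by (simp add: cycles_block_def)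
  qed
  note A = fixed_gf_cycles[of k ?h 0 d, OF blocks assms(1)]
  \<comment> \<open>The remaining points count as cycles of length 1, so that
    \<open>fixed_gf_cycles\<close> covers them too; \<open>1 * i\<close> keeps the form of that
    lemma.\<close>
  have fixed: "cycles_block ?h (d * k + 1 * i) 1" if "i < n - d * k" for i
    using that h[of "d * k + i"] by (simp add: cycles_block_def block_rotation_def)
  have B: "?h ` {d * k..<d * k + 1 * (n - d * k)} \<subseteq> {d * k..<d * k + 1 * (n - d * k)} \<and>
      fixed_gf ?h {d * k..<d * k + 1 * (n - d * k)} * (1 - fps_X ^ 1) ^ (n - d * k) = 1"
    by (rule fixed_gf_cycles) (rule fixed, simp_all)
  have split: "{..<n} = {0..<0 + d * k} \<union> {d * k..<d * k + 1 * (n - d * k)}" using assms(2) by auto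
  have "fixed_gf ?h {..<n} = fixed_gf ?h {0..<0 + d * k} * fixed_gf ?h {d * k..<d * k + 1 * (n - d * k)}"
    unfolding split by (rule fixed_gf_Un) (use A B in auto)
  then have "fixed_gf ?h {..<n} * ((1 - fps_X ^ d) ^ k * (1 - fps_X) ^ (n - d * k))
      = (fixed_gf ?h {0..<0 + d * k} * (1 - fps_X ^ d) ^ k) *
        (fixed_gf ?h {d * k..<d * k + 1 * (n - d * k)} * (1 - fps_X ^ 1) ^ (n - d * k))"
    by (simp only: power_one_right mult_ac)
  also have "\<dots> = 1" using A B by simp
  finally show "fixed_gf ?h {..<n} * ((1 - fps_X ^ d) ^ k * (1 - fps_X) ^ (n - d * k)) = 1" .
qed

section \<open>Assembling the bound on the dimension\<close>

lemma finite_p_regular: "finite (p_regular p n)"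
  by (rule finite_subset[OF _ finite_permutations[of "{1..n}"]])
    (auto simp: p_regular_def sym_group_carrier)

lemma brauer_sym_dim_ge:
  fixes \<theta> :: "'k::field alg_closure \<Rightarrow> complex"
  assumes "Factorial_Ring.prime p" "CHAR('k) = p" "brauer_lift p \<theta>"
  shows "brauer_sym_dim p \<theta> n \<ge> 1 + (\<Sum>d\<in>{d\<in>{2..n}. \<not> p dvd d}. n div d)"
proof -
  define D where "D = {d\<in>{2..n}. \<not> p dvd d}"
  \<comment> \<open>All pairs \<open>(1, k)\<close> would describe the identity, which is therefore
    represented once, by \<open>(1, 0)\<close>.\<close>
  define I where "I = insert (1, 0) (Sigma D (\<lambda>d. {1..n div d}))"
  have fin: "finite D" "finite I" by (auto simp: D_def I_def)
  have card: "card I = 1 + (\<Sum>d\<in>D. n div d)"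
    unfolding I_def using fin(1) by (subst card_insert_disjoint) auto
  have I: "d * k \<le> n \<and> (d = 1 \<and> k = 0 \<or> d \<ge> 2 \<and> k \<ge> 1) \<and> coprime d p" if "(d, k) \<in> I" for d k
  proof (cases "(d, k) = (1, 0)")
    case False
    then have d: "d \<in> D" "1 \<le> k" "k \<le> n div d" using that by (auto simp: I_def)
    then have "coprime d p"
      using prime_imp_coprime[OF assms(1)] by (auto simp: D_def coprime_commute)
    moreover have "d * k \<le> n"
      using d(3) by (meson le_trans mult_le_mono2 times_div_less_eq_dividend)
    ultimately show ?thesis using d by (auto simp: D_def)
  qed simp
  define gf where "gf g = fixed_gf (\<lambda>x. g (Suc x) - 1) {..<n}" for g :: "nat \<Rightarrow> nat"
  have "\<exists>g. g \<in> p_regular p n \<and> gf g * ((1 - fps_X ^ fst i) ^ snd i * (1 - fps_X) ^ (n - fst i * snd i)) = 1"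
    if "i \<in> I" for i
  proof -
    have "fst i > 0" "fst i * snd i \<le> n" "coprime (fst i) p"
      using that I[of "fst i" "snd i"] by auto
    then show ?thesis
      using ex_p_regular_fixed_gf[of "fst i" "snd i" n p] unfolding gf_def by blast
  qed
  then obtain y where y: "\<And>i. i \<in> I \<Longrightarrow> y i \<in> p_regular p n"
    "\<And>i. i \<in> I \<Longrightarrow> gf (y i) * ((1 - fps_X ^ fst i) ^ snd i * (1 - fps_X) ^ (n - fst i * snd i)) = 1"
    by metis
  have brauer: "brauer_sym p \<theta> n r (y i) = gf (y i) $ r" if "i \<in> I" for i r
    using brauer_sym_eq_card_fixed[OF assms(1-3) y(1)[OF that]]
    by (simp add: gf_def fixed_gf_def fixed_msets_def sym_monomials_def conj_assoc)
  have "card I \<le> vector_space.dim fun_scale (module.span fun_scale (range (brauer_sym p \<theta> n)))"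
  proof (rule card_le_dim_span[OF finite_p_regular[of p n] _ fin(2), where y = y])
    fix f g assume "f \<in> range (brauer_sym p \<theta> n)" "g \<notin> p_regular p n"
    then show "f g = 0" by (auto simp: brauer_sym_def)
  next
    fix c i assume c: "\<And>f. f \<in> range (brauer_sym p \<theta> n) \<Longrightarrow> (\<Sum>i\<in>I. c i * f (y i)) = 0" and "i \<in> I"
    \<comment> \<open>A relation that holds for the characters of every degree \<open>r\<close> is a
      relation between the generating functions, read coefficient by coefficient.\<close>
    have "(\<Sum>i\<in>I. fps_const (c i) * gf (y i)) = 0"
    proof (rule fps_ext)
      fix r
      have "(\<Sum>i\<in>I. fps_const (c i) * gf (y i)) $ r = (\<Sum>i\<in>I. c i * brauer_sym p \<theta> n r (y i))"
        by (simp add: fps_sum_nth brauer)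
      then show "(\<Sum>i\<in>I. fps_const (c i) * gf (y i)) $ r = 0 $ r" using c by simp
    qed
    then show "c i = 0"
      using y(2) I \<open>i \<in> I\<close>
      by (intro pole_orders_independent[OF fin(2), of n "\<lambda>i. gf (y i)" c]) force+
  qed
  then show ?thesis by (simp add: brauer_sym_dim_def card D_def)
qed

theorem proposition14:
  fixes p n :: nat and \<theta> :: "'k::field alg_closure \<Rightarrow> complex"
  assumes "Factorial_Ring.prime p" and "n \<ge> 1"
    and "CHAR('k) = p"
    and "brauer_lift p \<theta>"
  shows "real (brauer_sym_dim p \<theta> n) \<ge>
    (real p - 1) / real p * real n * ln (real n) +
    real n * (euler_mascheroni - 1 - (real p - 1) / real p - euler_mascheroni / real p)"
  using sum_div_not_dvd_ge[OF prime_ge_2_nat[OF assms(1)] assms(2)]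
    brauer_sym_dim_ge[OF assms(1,3,4), of n] by linarith

end
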